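(* Let $\xi(t)$ and $\eta(t)$, $t\ge0$, be two nonnegative measurable $\mathscr F_t$-adapted processes, $A_t$ a continuous nondecreasing $\mathscr F_t$-adapted process with $A_0=0$, and $M_t$ a local martingale with $M_0=0$. Suppose that $t\mapsto\xi(t)$ is càdlàg and $$\xi(t)\le\xi(0)+\int_0^t\eta(s)\,\mathrm ds+\int_0^t\xi(s)\,\mathrm dA_s+M_t,\qquad\forall t\ge0.$$ Then for any $0<q<p<1$ and $t\ge0$, $$\big[\mathbb E(\xi(t)^* )^q\big]^{1/q}\le\Big(\frac p{p-q}\Big)^{1/q}\Big(\mathbb E\,e^{pA_t/(1-p)}\Big)^{(1-p)/p}\,\mathbb E\Big(\xi(0)+\int_0^t\eta(s)\,\mathrm ds\Big),$$ where $\xi(t)^*:=\sup_{s\in[0,t]}\xi(s)$.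
   Context: All processes are defined on a filtered probability space $(\Omega,\mathscr F,(\mathscr F_t)_{t\ge0},\mathbb P)$ satisfying the usual conditions. Local martingales are with respect to $(\mathscr F_t)$, are càdlàg, and may be discontinuous. *)

theory Defs
  imports "HOL-Probability.Probability"
begin

text \<open>
  Time runs through \<open>[0,\<infinity>)\<close>. Filtrations and processes are indexed by \<^typ>\<open>real\<close>, and their
  values at negative times are never used.
\<close>

locale usual_filtered_prob_space = prob_space P + complete_measure P
  for P :: "'a measure" +
  fixes F :: "real \<Rightarrow> 'a measure"
  assumes subalgebra_F: "\<And>t. 0 \<le> t \<Longrightarrow> subalgebra P (F t)"
    and mono_F: "\<And>s t. 0 \<le> s \<Longrightarrow> s \<le> t \<Longrightarrow> sets (F s) \<subseteq> sets (F t)"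
    and null_sets_F: "null_sets P \<subseteq> sets (F 0)"
    and right_continuous_F: "\<And>t. 0 \<le> t \<Longrightarrow> sets (F t) = (\<Inter>s\<in>{t<..}. sets (F s))"

definition adapted :: "(real \<Rightarrow> 'a measure) \<Rightarrow> (real \<Rightarrow> 'a \<Rightarrow> real) \<Rightarrow> bool" where
  "adapted F X \<longleftrightarrow> (\<forall>t\<ge>0. X t \<in> borel_measurable (F t))"

definition measurable_process :: "'a measure \<Rightarrow> (real \<Rightarrow> 'a \<Rightarrow> real) \<Rightarrow> bool" where
  "measurable_process P X \<longleftrightarrow>
     (\<lambda>(t, \<omega>). X t \<omega>) \<in> borel_measurable (restrict_space borel {0..} \<Otimes>\<^sub>M P)"

definition cadlag :: "(real \<Rightarrow> real) \<Rightarrow> bool" where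
  "cadlag x \<longleftrightarrow>
     (\<forall>t\<ge>0. continuous (at_right t) x) \<and> (\<forall>t>0. \<exists>l. (x \<longlongrightarrow> l) (at_left t))"

definition martingale ::
    "'a measure \<Rightarrow> (real \<Rightarrow> 'a measure) \<Rightarrow> (real \<Rightarrow> 'a \<Rightarrow> real) \<Rightarrow> bool" where
  "martingale P F X \<longleftrightarrow> adapted F X \<and> (\<forall>t\<ge>0. integrable P (X t)) \<and>
     (\<forall>s t. 0 \<le> s \<longrightarrow> s \<le> t \<longrightarrow> (AE \<omega> in P. real_cond_exp P (F s) (X t) \<omega> = X s \<omega>))"

text \<open>
  Stopping times take values in \<open>[0,\<infinity>]\<close>. To apply \<^const>\<open>stopping_time\<close> to them, the filtration is
  extended to the index \<open>\<infinity>\<close>. Its value there is irrelevant, because \<open>{\<tau> \<le> \<infinity>}\<close> is the whole space.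
\<close>

definition extended_filtration ::
    "'a measure \<Rightarrow> (real \<Rightarrow> 'a measure) \<Rightarrow> ennreal \<Rightarrow> 'a measure" where
  "extended_filtration P F t = (if t = \<top> then P else F (enn2real t))"

definition stopped :: "(real \<Rightarrow> 'a \<Rightarrow> real) \<Rightarrow> ('a \<Rightarrow> ennreal) \<Rightarrow> real \<Rightarrow> 'a \<Rightarrow> real" where
  "stopped X \<tau> t \<omega> = X (enn2real (min (ennreal t) (\<tau> \<omega>))) \<omega>"

text \<open>
  Subtracting the initial value in the localised process avoids requiring \<open>X\<^sub>0\<close> to be integrable.
\<close>

definition local_martingale ::
    "'a measure \<Rightarrow> (real \<Rightarrow> 'a measure) \<Rightarrow> (real \<Rightarrow> 'a \<Rightarrow> real) \<Rightarrow> bool" where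
  "local_martingale P F X \<longleftrightarrow> adapted F X \<and> (AE \<omega> in P. cadlag (\<lambda>t. X t \<omega>)) \<and>
     (\<exists>\<tau> :: nat \<Rightarrow> 'a \<Rightarrow> ennreal.
        (\<forall>n. stopping_time (extended_filtration P F) (\<tau> n)) \<and>
        (AE \<omega> in P. incseq (\<lambda>n. \<tau> n \<omega>) \<and> (\<lambda>n. \<tau> n \<omega>) \<longlonglongrightarrow> \<top>) \<and>
        (\<forall>n. martingale P F (\<lambda>t \<omega>. stopped X (\<tau> n) t \<omega> - X 0 \<omega>)))"

text \<open>
  The measure \<open>dA\<close> of a continuous nondecreasing function on \<open>[0,\<infinity>)\<close>. The function is extended by
  its value at \<open>0\<close>, since \<^const>\<open>interval_measure\<close> expects a nondecreasing function on the whole line.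
\<close>

definition stieltjes_measure :: "(real \<Rightarrow> real) \<Rightarrow> real measure" where
  "stieltjes_measure a = interval_measure (\<lambda>s. a (max 0 s))"

text \<open>Real powers on \<open>[0,\<infinity>]\<close>, meant for positive exponents only.\<close>

definition ennreal_powr :: "ennreal \<Rightarrow> real \<Rightarrow> ennreal" where
  "ennreal_powr x r = (if x = \<top> then \<top> else ennreal (enn2real x powr r))"

end

theory Submission
  imports Defs "HOL-Real_Asymp.Real_Asymp"
begin

text \<open>
  The integrating factor \<open>e\<^sup>-\<^sup>A\<close> is applied on dyadic grids, which avoids stochastic integrals and
  optional stopping in continuous time. Put \<open>h = \<xi>(0) + \<integral>\<^sub>0\<^sup>t \<eta> ds\<close>, so that
  \<open>\<xi>(u) \<le> h + \<integral>\<^sub>0\<^sup>u \<xi> dA + M\<^sub>u\<close> on \<open>[0,t]\<close>. With \<open>\<phi>\<^sub>k = e\<^bsup>-A(t\<^sub>k)\<^esup>\<close>, the discrete product rule gives,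
  for every \<open>\<epsilon> > 0\<close>, all sufficiently fine grids and all grid points simultaneously,
  \<open>\<phi>\<^sub>j \<xi>(t\<^sub>j) \<le> h + \<epsilon> + \<Sum>\<^bsub>k<j\<^esub> \<phi>\<^sub>k (M(t\<^sub>k\<^sub>+\<^sub>1) - M(t\<^sub>k))\<close>. If \<open>M\<close> is a martingale, one stops the sum
  when \<open>\<xi> > \<kappa>\<close> or \<open>\<bar>M\<bar> > c\<close>: it has mean zero and is bounded by \<open>c\<close> plus the overshoot of \<open>\<bar>M\<bar>\<close>, so
  that refining the grid and then letting \<open>c \<rightarrow> \<infinity>\<close> yields \<open>\<kappa> E(e\<^bsup>-A(t)\<^esup>; \<xi>(t)\<^sup>* > \<kappa>) \<le> E h\<close>.
  Localisation extends this to local martingales. Young's inequality turns it into the tail bound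
  \<open>P(\<xi>(t)\<^sup>* > \<kappa>) \<le> (E h / \<kappa>)\<^sup>p (E e\<^bsup>p A(t) / (1 - p)\<^esup>)\<^bsup>1 - p\<^esup>\<close>, and integrating the tail gives the claim.
\<close>

section \<open>Cadlag paths and dyadic grids\<close>

text \<open>Bisection: boundedness passes from two adjacent intervals to their union, and around
  each single point the right limit and the left limit bound the path on the two sides.\<close>

lemma bounded_cadlag:
  assumes x: "cadlag x" and t: "0 \<le> t"
  obtains C where "\<And>s. s \<in> {0..t} \<Longrightarrow> \<bar>x s\<bar> \<le> C"
proof -
  define Q where "Q a b \<longleftrightarrow> (\<exists>C. \<forall>s\<in>{a..b} \<inter> {0..t}. \<bar>x s\<bar> \<le> C)" for a b
  have "Q 0 t"
  proof (rule Bolzano[OF t])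
    fix a b c assume ab: "Q a b" and bc: "Q b c" and "a \<le> b" "b \<le> c"
    obtain C1 C2 where "\<forall>s\<in>{a..b} \<inter> {0..t}. \<bar>x s\<bar> \<le> C1" "\<forall>s\<in>{b..c} \<inter> {0..t}. \<bar>x s\<bar> \<le> C2"
      using ab bc unfolding Q_def by blast
    then have "\<forall>s\<in>{a..c} \<inter> {0..t}. \<bar>x s\<bar> \<le> max C1 C2"
      by (metis IntE IntI atLeastAtMost_iff le_max_iff_disj linear)
    then show "Q a c" unfolding Q_def by blast
  next
    fix u assume u: "0 \<le> u" "u \<le> t"
    have "(x \<longlongrightarrow> x u) (at_right u)"
      using x u by (auto simp: cadlag_def continuous_within)
    then have "\<forall>\<^sub>F s in at_right u. dist (x s) (x u) < 1"
      by (rule tendstoD) simp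
    then obtain d1 where d1: "d1 > u" "\<And>s. u < s \<Longrightarrow> s < d1 \<Longrightarrow> dist (x s) (x u) < 1"
      unfolding eventually_at_right_field by blast
    \<comment> \<open>\<open>cadlag\<close> gives no left limit at 0. There the restriction to
      \<open>s\<ge>0\<close> makes the claim vacuous, so arbitrary values of \<open>l\<close> and
      \<open>d2 < 0\<close> serve.\<close>
    have "\<exists>l d2. d2 < u \<and> (\<forall>s\<ge>0. d2 < s \<longrightarrow> s < u \<longrightarrow> dist (x s) l < 1)"
    proof (cases "u = 0")
      case True
      then show ?thesis by (intro exI[of _ 0] exI[of _ "-1"]) auto
    next
      case False
      then have "\<exists>l. (x \<longlongrightarrow> l) (at_left u)"
        using x u by (auto simp: cadlag_def)
      then obtain l where "(x \<longlongrightarrow> l) (at_left u)" ..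
      then have "\<forall>\<^sub>F s in at_left u. dist (x s) l < 1"
        by (rule tendstoD) simp
      then show ?thesis unfolding eventually_at_left_field by blast
    qed
    then obtain l d2 where d2: "d2 < u" "\<And>s. 0 \<le> s \<Longrightarrow> d2 < s \<Longrightarrow> s < u \<Longrightarrow> dist (x s) l < 1"
      by blast
    define C where "C = \<bar>x u\<bar> + \<bar>l\<bar> + 1"
    have C: "\<bar>x s\<bar> \<le> C" if "0 \<le> s" "d2 < s" "s < d1" for s
      using d1(2)[of s] d2(2)[of s] that by (cases s u rule: linorder_cases) (auto simp: C_def dist_real_def)
    show "\<exists>d>0. \<forall>a b. a \<le> u \<and> u \<le> b \<and> b - a < d \<longrightarrow> Q a b"
      using d1(1) d2(1) unfolding Q_def
      by (intro exI[of _ "min (d1 - u) (u - d2)"]) (auto intro!: exI[of _ C] C)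
  qed
  then obtain C where "\<forall>s\<in>{0..t} \<inter> {0..t}. \<bar>x s\<bar> \<le> C" unfolding Q_def ..
  then show thesis using that[of C] by simp
qed

section \<open>Dyadic grids and rounding up to them\<close>

definition grid :: "real \<Rightarrow> nat \<Rightarrow> nat \<Rightarrow> real" where
  "grid t n k = t * real k / 2 ^ n"

lemma grid_0 [simp]: "grid t n 0 = 0"
  by (simp add: grid_def)

lemma grid_last [simp]: "grid t n (2 ^ n) = t"
  by (simp add: grid_def)

lemma grid_mono: "0 \<le> t \<Longrightarrow> k \<le> l \<Longrightarrow> grid t n k \<le> grid t n l"
  by (simp add: grid_def divide_right_mono mult_left_mono)

lemma grid_nonneg: "0 \<le> t \<Longrightarrow> 0 \<le> grid t n k"
  by (simp add: grid_def)

lemma grid_le: "0 \<le> t \<Longrightarrow> k \<le> 2 ^ n \<Longrightarrow> grid t n k \<le> t"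
  using grid_mono[of t k "2 ^ n" n] by simp

lemma grid_refine: "grid t n k = grid t (Suc n) (2 * k)"
  by (simp add: grid_def)

text \<open>Rounding goes up because paths are only right-continuous, so that points have to be
  approached from the right. For \<open>t = 0\<close> division by zero yields the value 0, which is
  then the only grid point.\<close>

definition grid_ceiling :: "real \<Rightarrow> nat \<Rightarrow> real \<Rightarrow> real" where
  "grid_ceiling t n s = t * real_of_int \<lceil>s * 2 ^ n / t\<rceil> / 2 ^ n"

lemma grid_ceiling_measurable [measurable]: "grid_ceiling t n \<in> borel_measurable borel"
  unfolding grid_ceiling_def by measurable

text \<open>Cells are open on the left and closed on the right, like the intervals into which the
  Stieltjes integral is split, so rounding up is constant on each of them.\<close>

lemma grid_ceiling_eq:
  assumes "grid t n k < s" "s \<le> grid t n (Suc k)" "0 \<le> t"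
  shows "grid_ceiling t n s = grid t n (Suc k)"
proof -
  have "t > 0"
    using assms by (cases "t = 0") (auto simp: grid_def)
  then have "\<lceil>s * 2 ^ n / t\<rceil> = int (Suc k)"
    using assms by (intro ceiling_unique) (auto simp: grid_def field_simps)
  then show ?thesis
    by (simp add: grid_ceiling_def grid_def)
qed

lemma grid_ceiling_bounds:
  assumes "0 < s" "s \<le> t"
  shows "s \<le> grid_ceiling t n s" "grid_ceiling t n s \<le> t" "grid_ceiling t n s < s + t / 2 ^ n"
proof -
  have t: "t > 0" using assms by simp
  let ?y = "s * 2 ^ n / t"
  have ty: "t * ?y = s * 2 ^ n" using t by simp
  have "t * ?y \<le> t * of_int \<lceil>?y\<rceil>" "t * of_int \<lceil>?y\<rceil> < t * (?y + 1)"
    by (rule mult_left_mono mult_strict_left_mono, use t in linarith, use t in simp)+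
  then have "s * 2 ^ n \<le> t * of_int \<lceil>?y\<rceil>" "t * of_int \<lceil>?y\<rceil> < s * 2 ^ n + t"
    unfolding distrib_left ty by auto
  then show "s \<le> grid_ceiling t n s" "grid_ceiling t n s < s + t / 2 ^ n"
    using t by (auto simp: grid_ceiling_def field_simps)
  have "?y \<le> 2 ^ n" using t assms by (simp add: field_simps)
  then have "\<lceil>?y\<rceil> \<le> 2 ^ n" by (simp add: ceiling_le_iff)
  then have "real_of_int \<lceil>?y\<rceil> \<le> 2 ^ n"
    by (metis of_int_le_iff of_int_numeral of_int_power)
  then show "grid_ceiling t n s \<le> t"
    using t by (simp add: grid_ceiling_def field_simps)
qed

lemma grid_ceiling_tendsto:
  assumes "0 < s" "s \<le> t"
  shows "(\<lambda>n. grid_ceiling t n s) \<longlonglongrightarrow> s"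
proof (rule tendsto_sandwich)
  show "\<forall>\<^sub>F n in sequentially. s \<le> grid_ceiling t n s"
    "\<forall>\<^sub>F n in sequentially. grid_ceiling t n s \<le> s + t / 2 ^ n"
    using grid_ceiling_bounds[OF assms] by (auto intro!: always_eventually less_imp_le)
  show "(\<lambda>n. s + t / 2 ^ n) \<longlonglongrightarrow> s" by real_asymp
qed simp

text \<open>Rounding up approaches \<open>s\<close> from the right. At \<open>s = t\<close> it is
  exact at every level, so right continuity is only asked for below \<open>t\<close>.\<close>

lemma grid_ceiling_tendsto_right_cont:
  fixes x :: "real \<Rightarrow> real"
  assumes "0 < s" "s \<le> t" and x: "\<And>s. 0 \<le> s \<Longrightarrow> s < t \<Longrightarrow> continuous (at_right s) x"
  shows "(\<lambda>n. x (grid_ceiling t n s)) \<longlonglongrightarrow> x s"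
proof (cases "s = t")
  case True
  then have "grid_ceiling t n s = s" for n
    using grid_ceiling_bounds[OF assms(1,2), of n] by simp
  then show ?thesis by simp
next
  case False
  have "continuous (at s within {s..}) x"
    using x[of s] assms False by (simp add: continuous_within at_within_Ici_at_right)
  then show ?thesis
    using grid_ceiling_tendsto[OF assms(1,2)] grid_ceiling_bounds(1)[OF assms(1,2)]
    by (auto simp: continuous_within_sequentially o_def)
qed

lemma grid_ceiling_eq_grid:
  assumes "0 < s" "s \<le> t"
  obtains k where "k \<le> 2 ^ n" "grid_ceiling t n s = grid t n k"
proof
  let ?k = "nat \<lceil>s * 2 ^ n / t\<rceil>"
  have t: "t > 0" using assms by simp
  have "0 \<le> s * 2 ^ n / t" using t assms by simp
  then have *: "real ?k = real_of_int \<lceil>s * 2 ^ n / t\<rceil>"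
    by (subst of_nat_nat) auto
  show eq: "grid_ceiling t n s = grid t n ?k"
    by (simp only: grid_ceiling_def grid_def *)
  have "real ?k \<le> 2 ^ n"
    using grid_ceiling_bounds(2)[OF assms, of n] t unfolding eq by (simp add: grid_def field_simps)
  then show "?k \<le> 2 ^ n"
    by (metis of_nat_le_iff of_nat_numeral of_nat_power)
qed

section \<open>The Stieltjes measure of a continuous nondecreasing function\<close>

lemma emeasure_stieltjes_measure:
  assumes c: "continuous_on {0..} a" and m: "mono_on {0..} a" and uv: "0 \<le> u" "u \<le> v"
  shows "emeasure (stieltjes_measure a) {u<..v} = ennreal (a v - a u)"
    and "emeasure (stieltjes_measure a) {u} = 0"
proof -
  \<comment> \<open>The constant extension below 0 stays continuous at 0. Hence the measure has no
    atoms on the half-line, and the endpoint 0 or a stopping time carries no mass.\<close>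
  let ?F = "\<lambda>s. a (max 0 s)"
  have F: "continuous_on UNIV ?F"
    by (rule continuous_on_compose2[OF c]) (auto intro!: continuous_intros)
  have Fm: "?F x \<le> ?F y" if "x \<le> y" for x y
    using that by (intro mono_onD[OF m]) auto
  have "continuous (at_right x) ?F" for x
    using F by (meson UNIV_I continuous_at_imp_continuous_at_within continuous_on_eq_continuous_at open_UNIV)
  then show "emeasure (stieltjes_measure a) {u<..v} = ennreal (a v - a u)"
    using uv emeasure_interval_measure_Ioc[of u v ?F] Fm by (simp add: stieltjes_measure_def max_def)
  show "emeasure (stieltjes_measure a) {u} = 0"
    using emeasure_interval_measure_Icc[of u u ?F] Fm F by (simp add: stieltjes_measure_def)
qed

lemma sets_stieltjes_measure [simp, measurable_cong]: "sets (stieltjes_measure a) = sets borel"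
  by (simp add: stieltjes_measure_def)

lemma space_stieltjes_measure [simp]: "space (stieltjes_measure a) = UNIV"
  by (simp add: stieltjes_measure_def)

section \<open>The pathwise inequality\<close>

lemma set_integrable_stieltjes:
  assumes a: "continuous_on {0..} a" "mono_on {0..} a" and uv: "0 \<le> u" "v \<le> t"
    and y: "set_borel_measurable borel {0..t} y" and C: "\<And>s. s \<in> {0..t} \<Longrightarrow> \<bar>y s\<bar> \<le> (C::real)"
  shows "set_integrable (stieltjes_measure a) {u<..v} y"
proof (cases "u \<le> v")
  case True
  \<comment> \<open>Measurability of \<open>y\<close> is known only after cutting off outside
    \<open>{0..t}\<close>. The cut-off function is therefore integrated first; the two agree on
    \<open>{u<..v}\<close>.\<close>
  have "set_integrable (stieltjes_measure a) {u<..v} (\<lambda>s. indicator {0..t} s * y s)"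
    unfolding set_integrable_def
  proof (rule integrableI_bounded_set_indicator[where B = C])
    show "(\<lambda>s. indicator {0..t} s * y s) \<in> borel_measurable (stieltjes_measure a)"
      using y by (simp add: set_borel_measurable_def measurable_cong_sets[of "stieltjes_measure a" borel])
    show "emeasure (stieltjes_measure a) {u<..v} < \<infinity>"
      using emeasure_stieltjes_measure(1)[OF a uv(1) True] by simp
    show "AE s in stieltjes_measure a. s \<in> {u<..v} \<longrightarrow> norm (indicator {0..t} s * y s) \<le> C"
      using C uv by (auto simp: indicator_def)
  qed simp
  then show ?thesis
    by (rule set_integrable_cong[THEN iffD1, rotated -1]) (use uv in auto)
qed (simp add: set_integrable_def)

text \<open>Let Y be h plus the integral of x da plus m, so that x \<le> Y. In the discrete product
  rule for exp(-a) Y, the growth from the integral and the loss from the decreasing factor nearly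
  cancel. Two errors remain: replacing x inside the integral by its value at the next grid point,
  and the second-order error of the exponential. Both are bounded uniformly in \<open>j\<close>, so
  one \<epsilon> serves all grid points.\<close>

lemma eventually_discounted_path_le:
  fixes x a m :: "real \<Rightarrow> real"
  assumes t: "0 \<le> t" and \<epsilon>: "0 < \<epsilon>"
    and x_meas: "set_borel_measurable borel {0..t} x"
    and x_nonneg: "\<And>s. s \<in> {0..t} \<Longrightarrow> 0 \<le> x s"
    and x_bound: "\<And>s. s \<in> {0..t} \<Longrightarrow> x s \<le> C"
    and x_right: "\<And>s. 0 \<le> s \<Longrightarrow> s < t \<Longrightarrow> continuous (at_right s) x"
    and a: "continuous_on {0..} a" "mono_on {0..} a" and a0: "a 0 = 0" and m0: "m 0 = 0"
    and le: "\<And>u. u \<in> {0..t} \<Longrightarrow> x u \<le> h + (LINT s:{0<..u}|stieltjes_measure a. x s) + m u"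
  shows "\<forall>\<^sub>F n in sequentially. \<forall>j \<le> 2 ^ n.
    exp (- a (grid t n j)) * x (grid t n j)
      \<le> h + (\<Sum>k<j. exp (- a (grid t n k)) * (m (grid t n (Suc k)) - m (grid t n k))) + \<epsilon>"
proof -
  let ?\<mu> = "stieltjes_measure a"
  define g where "g u = (LINT s:{0<..u}|?\<mu>. x s)" for u
  \<comment> \<open>The error of replacing x by its value at the next grid point;
    \<open>I n u\<close> accumulates it against da.\<close>
  define r where "r n s = \<bar>x s - x (grid_ceiling t n s)\<bar>" for n s
  define I where "I n u = (LINT s:{0<..u}|?\<mu>. r n s)" for n u
  have C0: "0 \<le> C" using x_nonneg[of 0] x_bound[of 0] t by simp
  have ceil_in: "grid_ceiling t n s \<in> {0..t}" if "s \<in> {0..t}" for n s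
  proof (cases "s = 0")
    case True then show ?thesis using t by (simp add: grid_ceiling_def)
  next
    case False then show ?thesis using grid_ceiling_bounds[of s t n] that by auto
  qed
  have xb: "\<bar>x s\<bar> \<le> C" if "s \<in> {0..t}" for s
    using x_nonneg[OF that] x_bound[OF that] by simp
  have rb: "\<bar>r n s\<bar> \<le> 2 * C" if "s \<in> {0..t}" for n s
    using xb[OF that] xb[OF ceil_in[OF that, of n]] by (auto simp: r_def)
  have [measurable]: "(\<lambda>s. indicator {0..t} s * x s) \<in> borel_measurable borel"
    using x_meas by (simp add: set_borel_measurable_def)
  have r_meas: "set_borel_measurable borel {0..t} (r n)" for n
  proof -
    \<comment> \<open>Since \<open>x\<close> is measurable only on \<open>{0..t}\<close>, an
      indicator is needed inside the composition with \<open>grid_ceiling\<close> too;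
      \<open>ceil_in\<close> shows that it changes nothing.\<close>
    have "(\<lambda>s. indicator {0..t} s * \<bar>(indicator {0..t} s * x s)
        - (indicator {0..t} (grid_ceiling t n s) * x (grid_ceiling t n s))\<bar>) \<in> borel_measurable borel"
      by measurable
    also have "(\<lambda>s. indicator {0..t} s * \<bar>(indicator {0..t} s * x s)
        - (indicator {0..t} (grid_ceiling t n s) * x (grid_ceiling t n s))\<bar>) = (\<lambda>s. indicator {0..t} s *\<^sub>R r n s)"
      using ceil_in by (auto simp: indicator_def r_def fun_eq_iff)
    finally show ?thesis by (simp add: set_borel_measurable_def)
  qed
  note x_int = set_integrable_stieltjes[OF a _ _ x_meas xb]
  note r_int = set_integrable_stieltjes[OF a _ _ r_meas rb]
  have split: "(LINT s:{0<..v}|?\<mu>. y s) = (LINT s:{0<..u}|?\<mu>. y s) + (LINT s:{u<..v}|?\<mu>. y s)"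
    if "0 \<le> u" "u \<le> v" "set_integrable ?\<mu> {0<..u} y" "set_integrable ?\<mu> {u<..v} y"
    for u v and y :: "real \<Rightarrow> real"
  proof -
    have "{0<..v} = {0<..u} \<union> {u<..v}" using that by auto
    then show ?thesis using that by (simp add: set_integral_Un)
  qed
  \<comment> \<open>Dominated convergence: right continuity sends the error to 0 pointwise, and the
    constant \<open>2 * C\<close> is integrable because da has finite mass on
    \<open>{0<..t}\<close>.\<close>
  have I_lim: "(\<lambda>n. I n t) \<longlonglongrightarrow> 0"
  proof -
    have "(\<lambda>n. LINT s|?\<mu>. indicator {0<..t} s *\<^sub>R r n s) \<longlonglongrightarrow> (LINT s|?\<mu>. 0)"
    proof (rule integral_dominated_convergence[where w = "\<lambda>s. indicator {0<..t} s *\<^sub>R (2 * C)"])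
      show "(\<lambda>s. indicator {0<..t} s *\<^sub>R r n s) \<in> borel_measurable ?\<mu>" for n
        using r_int[of 0 t n] t by (auto simp: set_integrable_def)
      show "integrable ?\<mu> (\<lambda>s. indicator {0<..t} s *\<^sub>R (2 * C))"
        using set_integrable_stieltjes[OF a, of 0 t t "\<lambda>_. 2 * C" "2 * C"] C0
        by (simp add: set_integrable_def set_borel_measurable_def)
      show "AE s in ?\<mu>. (\<lambda>n. indicator {0<..t} s *\<^sub>R r n s) \<longlonglongrightarrow> 0"
      proof (intro AE_I2)
        fix s
        show "(\<lambda>n. indicator {0<..t} s *\<^sub>R r n s) \<longlonglongrightarrow> 0"
        proof (cases "s \<in> {0<..t}")
          case True
          then have "(\<lambda>n. \<bar>x s - x (grid_ceiling t n s)\<bar>) \<longlonglongrightarrow> \<bar>x s - x s\<bar>"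
            by (intro tendsto_intros grid_ceiling_tendsto_right_cont x_right) auto
          then show ?thesis by (simp add: r_def indicator_def)
        qed simp
      qed
      show "AE s in ?\<mu>. norm (indicator {0<..t} s *\<^sub>R r n s) \<le> indicator {0<..t} s *\<^sub>R (2 * C)" for n
        using rb by (auto simp: indicator_def)
    qed simp
    then show ?thesis by (simp add: I_def set_lebesgue_integral_def)
  qed
  \<comment> \<open>Chosen so that the total second-order error, at most \<open>C * \<eta>\<close>,
    uses less than half of \<epsilon>. Writing \<open>C + 1\<close> avoids a zero
    denominator.\<close>
  define \<eta> where "\<eta> = \<epsilon> / (2 * (C + 1))"
  have \<eta>: "\<eta> > 0" "C * \<eta> < \<epsilon> / 2" using \<epsilon> C0 by (auto simp: \<eta>_def field_simps)
  have a_osc: "\<forall>\<^sub>F n in sequentially. \<forall>k<2^n. a (grid t n (Suc k)) - a (grid t n k) < \<eta>"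
  proof -
    have "uniformly_continuous_on {0..t} a"
      by (intro compact_uniformly_continuous continuous_on_subset[OF a(1)]) auto
    then obtain d where d: "d > 0" "\<And>u v. u \<in> {0..t} \<Longrightarrow> v \<in> {0..t} \<Longrightarrow> dist v u < d \<Longrightarrow> dist (a v) (a u) < \<eta>"
      unfolding uniformly_continuous_on_def using \<eta>(1) by metis
    have "(\<lambda>n. t / 2 ^ n) \<longlonglongrightarrow> 0" by real_asymp
    then have "\<forall>\<^sub>F n in sequentially. t / 2 ^ n < d"
      using d(1) by (simp add: order_tendstoD)
    then show ?thesis
    proof eventually_elim
      case (elim n)
      show ?case
      proof safe
        fix k :: nat assume k: "k < 2 ^ n"
        have "grid t n (Suc k) - grid t n k = t / 2 ^ n"
          by (simp add: grid_def field_simps)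
        then have "dist (a (grid t n (Suc k))) (a (grid t n k)) < \<eta>"
          using k t elim by (intro d(2)) (auto simp: dist_real_def grid_nonneg grid_le Suc_leI less_imp_le)
        then show "a (grid t n (Suc k)) - a (grid t n k) < \<eta>"
          by (simp add: dist_real_def)
      qed
    qed
  qed
  have "\<forall>\<^sub>F n in sequentially. I n t < \<epsilon> / 2"
    by (rule order_tendstoD(2)[OF I_lim]) (use \<epsilon> in simp)
  with a_osc show ?thesis
  proof eventually_elim
    case (elim n)
    define d where "d k = grid t n k" for k
    define \<phi> where "\<phi> k = exp (- a (d k))" for k
    define Y where "Y u = h + g u + m u" for u
    define N where "N j = (\<Sum>k<j. \<phi> k * (m (d (Suc k)) - m (d k)))" for j
    have d_in: "d k \<in> {0..t}" if "k \<le> 2 ^ n" for k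
      using that t by (simp add: d_def grid_nonneg grid_le)
    have d_mono: "d k \<le> d (Suc k)" for k
      using t by (simp add: d_def grid_mono)
    \<comment> \<open>The last term is the telescoped sum of the errors
      \<open>C * \<eta> * (\<phi> k - \<phi> (Suc k))\<close> of single steps. It stays below
      \<open>C * \<eta>\<close> however many grid points there are.\<close>
    have main: "\<phi> j * Y (d j) \<le> h + N j + I n (d j) + C * \<eta> * (1 - \<phi> j)" if "j \<le> 2 ^ n" for j
      using that
    proof (induction j)
      case 0
      then show ?case by (simp add: d_def \<phi>_def Y_def N_def I_def g_def a0 m0 set_lebesgue_integral_def)
    next
      case (Suc j)
      let ?u = "d j" and ?v = "d (Suc j)"
      let ?\<Delta> = "a ?v - a ?u"
      have uv: "0 \<le> ?u" "?u \<le> ?v" "?v \<le> t" "?u \<in> {0..t}" "?v \<in> {0..t}"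
        using d_in[of j] d_in[of "Suc j"] d_mono[of j] Suc.prems by auto
      have \<Delta>: "0 \<le> ?\<Delta>" "?\<Delta> < \<eta>"
        using uv elim Suc.prems by (auto intro!: mono_onD[OF a(2)] simp: d_def)
      have \<phi>j: "0 < \<phi> j" "\<phi> j \<le> 1"
        using mono_onD[OF a(2), of 0 ?u] uv by (auto simp: \<phi>_def a0)
      have \<phi>_dec: "\<phi> (Suc j) \<le> \<phi> j" using \<Delta> by (simp add: \<phi>_def)
      \<comment> \<open>The first-order increment \<open>\<phi> j * ?\<Delta>\<close> exceeds the
        true drop of \<phi> by at most the drop times \<open>?\<Delta>\<close>, because exp lies
        above its tangent.\<close>
      have \<phi>_step: "\<phi> j * ?\<Delta> - (\<phi> j - \<phi> (Suc j)) \<le> (\<phi> j - \<phi> (Suc j)) * \<eta>"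
      proof -
        have "\<phi> j = \<phi> (Suc j) * exp ?\<Delta>"
          by (simp add: \<phi>_def flip: exp_add)
        moreover have "1 + ?\<Delta> \<le> exp ?\<Delta>" by (rule exp_ge_add_one_self)
        ultimately have "\<phi> (Suc j) * (1 + ?\<Delta>) \<le> \<phi> j"
          by (simp add: \<phi>_def)
        then have "\<phi> j * ?\<Delta> - (\<phi> j - \<phi> (Suc j)) \<le> (\<phi> j - \<phi> (Suc j)) * ?\<Delta>"
          by (simp add: algebra_simps)
        also have "\<dots> \<le> (\<phi> j - \<phi> (Suc j)) * \<eta>"
          using \<Delta> \<phi>_dec by (intro mult_left_mono) auto
        finally show ?thesis .
      qed
      \<comment> \<open>On the cell, rounding up gives the right endpoint \<open>?v\<close>, so x is
        at most \<open>r n\<close> plus the constant \<open>x ?v\<close>.\<close>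
      have g_step: "g ?v - g ?u \<le> (I n ?v - I n ?u) + x ?v * ?\<Delta>"
      proof -
        have "g ?v - g ?u = (LINT s:{?u<..?v}|?\<mu>. x s)"
          unfolding g_def using uv by (subst split[of ?u ?v]) (auto intro!: x_int)
        also have "\<dots> \<le> (LINT s:{?u<..?v}|?\<mu>. r n s + x ?v)"
        proof (rule set_integral_mono)
          show "set_integrable ?\<mu> {?u<..?v} x" using uv by (intro x_int)
          show "set_integrable ?\<mu> {?u<..?v} (\<lambda>s. r n s + x ?v)"
            using uv by (intro set_integral_add r_int set_integrable_stieltjes[OF a, of _ _ t _ "\<bar>x ?v\<bar>"])
              (auto simp: set_borel_measurable_def)
          fix s assume "s \<in> {?u<..?v}"
          then have "grid_ceiling t n s = ?v"
            using t by (simp add: d_def grid_ceiling_eq)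
          then show "x s \<le> r n s + x ?v" by (simp add: r_def)
        qed
        also have "\<dots> = (LINT s:{?u<..?v}|?\<mu>. r n s) + (LINT s:{?u<..?v}|?\<mu>. x ?v)"
          using uv by (intro set_integral_add r_int set_integrable_stieltjes[OF a, of _ _ t _ "\<bar>x ?v\<bar>"])
              (auto simp: set_borel_measurable_def)
        also have "(LINT s:{?u<..?v}|?\<mu>. r n s) = I n ?v - I n ?u"
          unfolding I_def using uv by (subst split[of ?u ?v]) (auto intro!: r_int)
        also have "(LINT s:{?u<..?v}|?\<mu>. x ?v) = x ?v * ?\<Delta>"
          using emeasure_stieltjes_measure(1)[OF a, of ?u ?v] uv \<Delta>
          by (simp add: set_lebesgue_integral_def measure_def)
        finally show ?thesis .
      qed
      have I_step: "0 \<le> I n ?v - I n ?u"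
      proof -
        have "I n ?v - I n ?u = (LINT s:{?u<..?v}|?\<mu>. r n s)"
          unfolding I_def using uv by (subst split[of ?u ?v]) (auto intro!: r_int)
        also have "0 \<le> \<dots>"
          by (auto simp: set_lebesgue_integral_def r_def intro!: integral_nonneg_AE)
        finally show ?thesis .
      qed
      have "\<phi> j * (g ?v - g ?u) \<le> \<phi> j * ((I n ?v - I n ?u) + x ?v * ?\<Delta>)"
        using g_step \<phi>j by (intro mult_left_mono) auto
      also have "\<dots> \<le> (I n ?v - I n ?u) + x ?v * (\<phi> j * ?\<Delta>)"
        using \<phi>j I_step mult_right_mono[of "\<phi> j" 1 "I n ?v - I n ?u"] by (simp add: algebra_simps)
      finally have 1: "\<phi> j * (g ?v - g ?u) \<le> (I n ?v - I n ?u) + x ?v * (\<phi> j * ?\<Delta>)" .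
      \<comment> \<open>The assumed inequality at \<open>?v\<close> says x \<le> Y. It lets the
        subtracted term of the product rule be expressed through \<open>x ?v\<close>, where it
        cancels the growth term in \<open>1\<close> up to second order.\<close>
      have 2: "(\<phi> j - \<phi> (Suc j)) * x ?v \<le> (\<phi> j - \<phi> (Suc j)) * Y ?v"
        using le[OF uv(5)] \<phi>_dec by (intro mult_left_mono) (auto simp: Y_def g_def)
      have "x ?v * (\<phi> j * ?\<Delta> - (\<phi> j - \<phi> (Suc j))) \<le> x ?v * ((\<phi> j - \<phi> (Suc j)) * \<eta>)"
        using x_nonneg[OF uv(5)] \<phi>_step by (intro mult_left_mono)
      also have "\<dots> \<le> C * ((\<phi> j - \<phi> (Suc j)) * \<eta>)"
        using x_bound[OF uv(5)] \<phi>_dec \<eta>(1) by (intro mult_right_mono) auto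
      finally have 3: "x ?v * (\<phi> j * ?\<Delta> - (\<phi> j - \<phi> (Suc j))) \<le> C * \<eta> * (\<phi> j - \<phi> (Suc j))"
        by (simp add: algebra_simps)
      \<comment> \<open>Discrete product rule with the increment of \<phi> weighted by the value of
        Y at the right endpoint.\<close>
      have "\<phi> (Suc j) * Y ?v = \<phi> j * Y ?u + \<phi> j * (g ?v - g ?u) + \<phi> j * (m ?v - m ?u)
          - (\<phi> j - \<phi> (Suc j)) * Y ?v"
        by (simp add: Y_def algebra_simps)
      also have "\<dots> \<le> h + N j + I n ?u + C * \<eta> * (1 - \<phi> j)
          + ((I n ?v - I n ?u) + x ?v * (\<phi> j * ?\<Delta>)) + \<phi> j * (m ?v - m ?u) - (\<phi> j - \<phi> (Suc j)) * x ?v"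
        using Suc 1 2 by linarith
      also have "\<dots> = h + N (Suc j) + I n ?v + C * \<eta> * (1 - \<phi> j) + x ?v * (\<phi> j * ?\<Delta> - (\<phi> j - \<phi> (Suc j)))"
        by (simp add: N_def algebra_simps)
      also have "\<dots> \<le> h + N (Suc j) + I n ?v + C * \<eta> * (1 - \<phi> j) + C * \<eta> * (\<phi> j - \<phi> (Suc j))"
        using 3 by linarith
      also have "\<dots> = h + N (Suc j) + I n ?v + C * \<eta> * (1 - \<phi> (Suc j))"
        by (simp add: algebra_simps)
      finally show ?case .
    qed
    have "\<phi> j * x (d j) \<le> h + N j + \<epsilon>" if j: "j \<le> 2 ^ n" for j
    proof -
      have "\<phi> j * x (d j) \<le> \<phi> j * Y (d j)"
        using le[OF d_in[OF j]] by (intro mult_left_mono) (auto simp: Y_def g_def \<phi>_def)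
      moreover have "I n (d j) \<le> I n t"
      proof -
        have "I n t - I n (d j) = (LINT s:{d j<..t}|?\<mu>. r n s)"
          unfolding I_def using d_in[OF j] by (subst split[of "d j" t]) (auto intro!: r_int)
        also have "0 \<le> \<dots>"
          by (auto simp: set_lebesgue_integral_def r_def intro!: integral_nonneg_AE)
        finally show ?thesis by simp
      qed
      moreover have "C * \<eta> * (1 - \<phi> j) \<le> C * \<eta> * 1"
        using C0 \<eta>(1) by (intro mult_left_mono) (auto simp: \<phi>_def)
      ultimately show ?thesis using main[OF j] elim(2) \<eta>(2) by linarith
    qed
    then show ?case by (simp add: \<phi>_def d_def N_def)
  qed
qed

section \<open>Maximal inequalities\<close>

lemma pred_ex_atMost:
  assumes "\<And>k. k \<le> n \<Longrightarrow> Measurable.pred M (Q k)"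
  shows "Measurable.pred M (\<lambda>x. \<exists>k\<le>(n::nat). Q k x)"
proof -
  have "Measurable.pred M (\<lambda>x. \<exists>k\<in>{..n}. Q k x)"
    by (rule pred_intros_finite) (use assms in auto)
  then show ?thesis unfolding Bex_def atMost_iff .
qed

text \<open>\<open>?S\<close> is the sum stopped at the first index J where \<open>\<xi>\<close>
  exceeds \<kappa> or X leaves [-c, c]. Outside \<open>D\<close>, the assumed inequality at J bounds
  \<open>h + \<epsilon> + ?S\<close> below by \<open>\<phi> J * \<xi> J\<close>; if \<open>W\<close>
  fails and \<kappa> was exceeded, it was \<open>\<xi>\<close> that caused the stop, and this
  product is at least \<open>\<kappa> * w\<close>. On \<open>D\<close> the left side is 0, and the
  last two terms compensate a negative \<open>?S\<close>, since summation by parts bounds its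
  modulus by c plus the overshoot of X at J.\<close>

lemma stopped_transform_bound:
  fixes X \<phi> \<xi> :: "nat \<Rightarrow> real"
  assumes \<phi>0: "\<phi> 0 \<le> 1" and \<phi>_dec: "\<And>k. k < N \<Longrightarrow> \<phi> (Suc k) \<le> \<phi> k" and w: "0 \<le> w" "w \<le> \<phi> N"
    and X0: "X 0 = 0" and \<xi>: "\<And>k. k \<le> N \<Longrightarrow> 0 \<le> \<xi> k" and pos: "0 \<le> h" "0 \<le> \<epsilon>" "0 \<le> \<kappa>" "0 \<le> c"
    and W: "\<And>k. k \<le> N \<Longrightarrow> c < \<bar>X k\<bar> \<Longrightarrow> W"
    and D: "\<And>j. j \<le> N \<Longrightarrow> \<not> D \<Longrightarrow> \<phi> j * \<xi> j \<le> h + (\<Sum>k<j. \<phi> k * (X (Suc k) - X k)) + \<epsilon>"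
  shows "\<kappa> * (w * of_bool ((\<exists>k\<le>N. \<kappa> < \<xi> k) \<and> \<not> W \<and> \<not> D))
    \<le> h + \<epsilon> + (\<Sum>k<N. of_bool (\<forall>i\<le>k. \<xi> i \<le> \<kappa> \<and> \<bar>X i\<bar> \<le> c) * (\<phi> k * (X (Suc k) - X k)))
      + c * of_bool D + (\<Sum>k\<le>N. \<bar>X k\<bar> * of_bool ((\<forall>i<k. \<xi> i \<le> \<kappa> \<and> \<bar>X i\<bar> \<le> c) \<and> c < \<bar>X k\<bar>))"
    (is "?L \<le> h + \<epsilon> + ?S + c * of_bool D + ?R")
proof -
  \<comment> \<open>The alternative \<open>k = N\<close> makes the least index exist even if nothing
    triggers the stop.\<close>
  define J where "J = (LEAST k. k = N \<or> \<not> (\<xi> k \<le> \<kappa> \<and> \<bar>X k\<bar> \<le> c))"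
  have J: "J = N \<or> \<not> (\<xi> J \<le> \<kappa> \<and> \<bar>X J\<bar> \<le> c)"
    unfolding J_def by (rule LeastI[of _ N]) simp
  have JN: "J \<le> N" unfolding J_def by (rule Least_le) simp
  have before: "\<xi> k \<le> \<kappa> \<and> \<bar>X k\<bar> \<le> c" if "k < J" for k
    using not_less_Least[of k] that unfolding J_def by blast
  have alive: "(\<forall>i\<le>k. \<xi> i \<le> \<kappa> \<and> \<bar>X i\<bar> \<le> c) \<longleftrightarrow> k < J" if "k < N" for k
    using before J JN that by (metis le_less_trans not_le order_refl)
  have S: "?S = (\<Sum>k<J. \<phi> k * (X (Suc k) - X k))"
  proof -
    have "?S = (\<Sum>k<N. if k < J then \<phi> k * (X (Suc k) - X k) else 0)"
      by (intro sum.cong) (auto simp: alive)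
    also have "\<dots> = (\<Sum>k\<in>{..<N} \<inter> {k. k < J}. \<phi> k * (X (Suc k) - X k))"
      by (simp add: sum.If_cases)
    also have "{..<N} \<inter> {k. k < J} = {..<J}" using JN by auto
    finally show ?thesis .
  qed
  have \<phi>_mono: "\<phi> l \<le> \<phi> k" if "k \<le> l" "l \<le> N" for k l
    using that
  proof (induction l rule: dec_induct)
    case (step n)
    then show ?case using \<phi>_dec[of n] by auto
  qed simp
  have \<phi>_pos: "0 \<le> \<phi> k" "w \<le> \<phi> k" if "k \<le> N" for k
    using \<phi>_mono[of k N] that w by auto
  \<comment> \<open>Before J the values of X are at most c in modulus, so only the value at J can
    overshoot.\<close>
  define K where "K = max c \<bar>X J\<bar>"
  have XK: "\<bar>X k\<bar> \<le> K" if "k \<le> J" for k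
    using before[of k] that by (cases "k = J") (auto simp: K_def)
  have K0: "0 \<le> K" using XK[of J] by simp
  \<comment> \<open>Summation by parts: the differences of \<phi> are nonnegative and telescope, so
    the bound does not grow with the number of steps.\<close>
  have "\<bar>(\<Sum>k<j. \<phi> k * (X (Suc k) - X k)) - \<phi> j * X j\<bar> \<le> K * (\<phi> 0 - \<phi> j)" if "j \<le> J" for j
    using that
  proof (induction j)
    case 0
    then show ?case by (simp add: X0)
  next
    case (Suc j)
    have "(\<Sum>k<Suc j. \<phi> k * (X (Suc k) - X k)) - \<phi> (Suc j) * X (Suc j)
        = ((\<Sum>k<j. \<phi> k * (X (Suc k) - X k)) - \<phi> j * X j) + (\<phi> j - \<phi> (Suc j)) * X (Suc j)"
      by (simp add: algebra_simps)
    also have "\<bar>\<dots>\<bar> \<le> K * (\<phi> 0 - \<phi> j) + \<bar>(\<phi> j - \<phi> (Suc j)) * X (Suc j)\<bar>"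
      using Suc by linarith
    also have "\<bar>(\<phi> j - \<phi> (Suc j)) * X (Suc j)\<bar> \<le> (\<phi> j - \<phi> (Suc j)) * K"
      using \<phi>_dec[of j] XK[of "Suc j"] Suc.prems JN by (auto simp: abs_mult intro!: mult_left_mono)
    finally show ?case by (simp add: algebra_simps)
  qed
  from this[of J] have "\<bar>?S - \<phi> J * X J\<bar> \<le> K * (\<phi> 0 - \<phi> J)" by (simp add: S)
  moreover have "\<bar>\<phi> J * X J\<bar> \<le> \<phi> J * K"
    using \<phi>_pos[OF JN] XK[of J] by (auto simp: abs_mult intro!: mult_left_mono)
  moreover have "K * \<phi> 0 \<le> K" using mult_left_mono[OF \<phi>0 K0] by simp
  ultimately have SK: "\<bar>?S\<bar> \<le> K" by (simp add: algebra_simps)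
  have R0: "0 \<le> ?R" by (intro sum_nonneg) auto
  \<comment> \<open>In the case of an overshoot, the term of \<open>?R\<close> with index J is
    exactly \<open>\<bar>X J\<bar>\<close>.\<close>
  have KR: "K \<le> c + ?R"
  proof (cases "\<bar>X J\<bar> \<le> c")
    case True
    then show ?thesis using R0 by (simp add: K_def)
  next
    case False
    have "\<bar>X J\<bar> * of_bool ((\<forall>i<J. \<xi> i \<le> \<kappa> \<and> \<bar>X i\<bar> \<le> c) \<and> c < \<bar>X J\<bar>) \<le> ?R"
      using JN by (intro member_le_sum) auto
    then show ?thesis using False before pos by (auto simp: K_def)
  qed
  show ?thesis
  proof (cases D)
    case True
    then have "?L = 0" "c * of_bool D = c" by simp_all
    then show ?thesis using SK KR pos by linarith
  next
    case False
    have cD: "c * of_bool D = 0" using False by simp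
    have le: "\<phi> J * \<xi> J \<le> h + ?S + \<epsilon>" using D[OF JN False] by (simp add: S)
    show ?thesis
    proof (cases "(\<exists>k\<le>N. \<kappa> < \<xi> k) \<and> \<not> W")
      case True
      then obtain k where k: "k \<le> N" "\<kappa> < \<xi> k" by blast
      have "J \<le> k" using before[of k] k by (meson not_le)
      have "\<kappa> < \<xi> J"
      proof (cases "J = N")
        case True
        then show ?thesis using k \<open>J \<le> k\<close> by simp
      next
        case False
        then show ?thesis using J W[OF JN] True by force
      qed
      have "\<kappa> * w \<le> \<xi> J * \<phi> J"
        using \<open>\<kappa> < \<xi> J\<close> \<phi>_pos[OF JN] w pos by (intro mult_mono) auto
      then have "?L \<le> \<phi> J * \<xi> J" using True False by (simp add: mult.commute)
      also have "\<dots> \<le> h + \<epsilon> + ?S + ?R" using le R0 by linarith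
      finally show ?thesis using cD by linarith
    next
      case F: False
      have "0 \<le> \<phi> J * \<xi> J" using \<phi>_pos[OF JN] \<xi>[OF JN] by simp
      then have "0 \<le> h + \<epsilon> + ?S + ?R" using le R0 by linarith
      moreover have "?L = 0" using F by auto
      ultimately show ?thesis using cD by linarith
    qed
  qed
qed

text \<open>Expectation of \<open>stopped_transform_bound\<close>. The stopped sum has mean zero,
  and the overshoot is charged to disjoint events \<open>R k\<close>, on each of which
  \<open>\<bar>X k\<bar>\<close> may be replaced by \<open>\<bar>X N\<bar>\<close> as |X| is a
  submartingale. The resulting bound depends on the grid only through \<open>D\<close>, once
  \<open>W\<close> and \<open>X N\<close> are kept fixed. \<open>D\<close> need not be adapted, so
  it enters as an error probability and not in the stopping rule.\<close>

lemma (in prob_space) discrete_maximal: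
  fixes G :: "nat \<Rightarrow> 'a measure" and X \<phi> \<xi> :: "nat \<Rightarrow> 'a \<Rightarrow> real"
  assumes sub: "\<And>k. k \<le> N \<Longrightarrow> subalgebra M (G k)"
    and mono: "\<And>k l. k \<le> l \<Longrightarrow> l \<le> N \<Longrightarrow> sets (G k) \<subseteq> sets (G l)"
    and X_meas: "\<And>k. k \<le> N \<Longrightarrow> X k \<in> borel_measurable (G k)"
    and X_int: "\<And>k. k \<le> N \<Longrightarrow> integrable M (X k)"
    and X_mart: "\<And>k. k \<le> N \<Longrightarrow> AE \<omega> in M. real_cond_exp M (G k) (X N) \<omega> = X k \<omega>"
    and X0: "AE \<omega> in M. X 0 \<omega> = 0"
    and \<phi>_meas: "\<And>k. k \<le> N \<Longrightarrow> \<phi> k \<in> borel_measurable (G k)"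
    and \<phi>: "AE \<omega> in M. \<phi> 0 \<omega> \<le> 1 \<and> (\<forall>k<N. \<phi> (Suc k) \<omega> \<le> \<phi> k \<omega>) \<and> 0 \<le> \<phi> N \<omega>"
    and \<xi>_meas: "\<And>k. k \<le> N \<Longrightarrow> \<xi> k \<in> borel_measurable (G k)"
    and \<xi>: "AE \<omega> in M. \<forall>k\<le>N. 0 \<le> \<xi> k \<omega>"
    and h: "integrable M h" "AE \<omega> in M. 0 \<le> h \<omega>" and pos: "0 \<le> \<epsilon>" "0 \<le> \<kappa>" "0 \<le> c"
    and W_meas: "Measurable.pred M W" and W: "\<And>k \<omega>. \<omega> \<in> space M \<Longrightarrow> k \<le> N \<Longrightarrow> c < \<bar>X k \<omega>\<bar> \<Longrightarrow> W \<omega>"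
    and D_meas: "Measurable.pred M D"
    and D: "\<And>j \<omega>. \<omega> \<in> space M \<Longrightarrow> j \<le> N \<Longrightarrow> \<not> D \<omega> \<Longrightarrow>
      \<phi> j \<omega> * \<xi> j \<omega> \<le> h \<omega> + (\<Sum>k<j. \<phi> k \<omega> * (X (Suc k) \<omega> - X k \<omega>)) + \<epsilon>"
  shows "\<kappa> * expectation (\<lambda>\<omega>. \<phi> N \<omega> * of_bool ((\<exists>k\<le>N. \<kappa> < \<xi> k \<omega>) \<and> \<not> W \<omega> \<and> \<not> D \<omega>))
    \<le> expectation h + \<epsilon> + c * expectation (\<lambda>\<omega>. of_bool (D \<omega>)) + expectation (\<lambda>\<omega>. \<bar>X N \<omega>\<bar> * of_bool (W \<omega>))"
proof -
  have G_M: "f \<in> borel_measurable M" if "f \<in> borel_measurable (G k)" "k \<le> N" for f :: "'a \<Rightarrow> real" and k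
    using measurable_from_subalg[OF sub] that by blast
  have G_mono: "f \<in> borel_measurable (G l)" if "f \<in> borel_measurable (G k)" "k \<le> l" "l \<le> N" for f :: "'a \<Rightarrow> real" and k l
  proof (rule measurable_from_subalg[OF _ that(1)])
    show "subalgebra (G l) (G k)"
      using sub[of k] sub[of l] mono[of k l] that by (auto simp: subalgebra_def)
  qed
  have pred_M: "Measurable.pred M Q" if "Measurable.pred (G k) Q" "k \<le> N" for Q k
    using measurable_from_subalg[OF sub] that by blast
  have [measurable]: "X k \<in> borel_measurable M" "\<phi> k \<in> borel_measurable M" "\<xi> k \<in> borel_measurable M"
    if "k \<le> N" for k
    using G_M X_meas \<phi>_meas \<xi>_meas that by blast+
  note [measurable] = W_meas D_meas
  define ok where "ok i \<omega> \<longleftrightarrow> \<xi> i \<omega> \<le> \<kappa> \<and> \<bar>X i \<omega>\<bar> \<le> c" for i \<omega>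
  have ok_meas: "Measurable.pred (G k) (ok i)" if "i \<le> k" "k \<le> N" for i k
  proof -
    have [measurable]: "X i \<in> borel_measurable (G k)" "\<xi> i \<in> borel_measurable (G k)"
      using that by (auto intro!: G_mono[of _ i k] X_meas \<xi>_meas)
    show ?thesis unfolding ok_def by measurable
  qed
  define alive where "alive k \<omega> \<longleftrightarrow> (\<forall>i\<le>k. ok i \<omega>)" for k \<omega>
  have alive_meas: "Measurable.pred (G k) (alive k)" if "k \<le> N" for k
  proof -
    have "Measurable.pred (G k) (\<lambda>\<omega>. \<forall>i\<in>{..k}. ok i \<omega>)"
      by (rule pred_intros_finite) (use ok_meas that in auto)
    then show ?thesis unfolding alive_def Ball_def atMost_iff .
  qed
  define R where "R k \<omega> \<longleftrightarrow> (\<forall>i<k. ok i \<omega>) \<and> c < \<bar>X k \<omega>\<bar>" for k \<omega>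
  have R_meas: "Measurable.pred (G k) (R k)" if "k \<le> N" for k
  proof -
    have "Measurable.pred (G k) (\<lambda>\<omega>. \<forall>i\<in>{..<k}. ok i \<omega>)"
      by (rule pred_intros_finite) (use ok_meas that in auto)
    then have 1: "Measurable.pred (G k) (\<lambda>\<omega>. \<forall>i<k. ok i \<omega>)"
      unfolding Ball_def lessThan_iff .
    have [measurable]: "X k \<in> borel_measurable (G k)" using X_meas that by blast
    have "Measurable.pred (G k) (\<lambda>\<omega>. c < \<bar>X k \<omega>\<bar>)" by measurable
    with 1 show ?thesis unfolding R_def by (rule pred_intros_logic(3))
  qed
  \<comment> \<open>The martingale property tested against bounded weights known at index k; every
    later use of it has this form.\<close>
  have cond: "expectation (\<lambda>\<omega>. f \<omega> * X N \<omega>) = expectation (\<lambda>\<omega>. f \<omega> * X k \<omega>)"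
    and cond_int: "integrable M (\<lambda>\<omega>. f \<omega> * X N \<omega>)" "integrable M (\<lambda>\<omega>. f \<omega> * X k \<omega>)"
    if f: "f \<in> borel_measurable (G k)" "AE \<omega> in M. \<bar>f \<omega>\<bar> \<le> 1" and k: "k \<le> N" for f k
  proof -
    interpret finite_measure_subalgebra M "G k"
      by unfold_locales (use sub[OF k] in auto)
    have [measurable]: "f \<in> borel_measurable M" using G_M f k by blast
    have bnd: "AE \<omega> in M. norm (f \<omega> * Z \<omega>) \<le> norm (Z \<omega>)" for Z :: "'a \<Rightarrow> real"
      using f(2) by eventually_elim (simp add: abs_mult mult_left_le_one_le)
    show 1: "integrable M (\<lambda>\<omega>. f \<omega> * X N \<omega>)" "integrable M (\<lambda>\<omega>. f \<omega> * X k \<omega>)"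
      using k X_int by (auto intro!: Bochner_Integration.integrable_bound[OF _ _ bnd])
    have "expectation (\<lambda>\<omega>. f \<omega> * X N \<omega>) = expectation (\<lambda>\<omega>. f \<omega> * real_cond_exp M (G k) (X N) \<omega>)"
      using 1 f by (intro real_cond_exp_intg(2)[symmetric]) auto
    also have "\<dots> = expectation (\<lambda>\<omega>. f \<omega> * X k \<omega>)"
      using X_mart[OF k] k f by (intro integral_cong_AE) (auto intro!: borel_measurable_times)
    finally show "expectation (\<lambda>\<omega>. f \<omega> * X N \<omega>) = expectation (\<lambda>\<omega>. f \<omega> * X k \<omega>)" .
  qed
  have \<phi>1: "AE \<omega> in M. \<forall>k\<le>N. 0 \<le> \<phi> k \<omega> \<and> \<phi> k \<omega> \<le> 1"
    using \<phi>
  proof eventually_elim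
    case (elim \<omega>)
    have *: "\<phi> l \<omega> \<le> \<phi> k \<omega>" if "k \<le> l" "l \<le> N" for k l
      using that
    proof (induction l rule: dec_induct)
      case (step n)
      then have "\<phi> (Suc n) \<omega> \<le> \<phi> n \<omega>" using elim by auto
      then show ?case using step by auto
    qed simp
    show ?case using *[of _ N] *[of 0] elim by (auto intro: order_trans)
  qed
  define S where "S k \<omega> = of_bool (alive k \<omega>) * (\<phi> k \<omega> * (X (Suc k) \<omega> - X k \<omega>))" for k \<omega>
  have S: "integrable M (S k)" "expectation (S k) = 0" if k: "k < N" for k
  proof -
    \<comment> \<open>This weight is measurable at index k and hence at \<open>Suc k\<close>. Both
      products in the increment therefore have the same mean as \<open>f * X N\<close>.\<close>
    define f where "f \<omega> = of_bool (alive k \<omega>) * \<phi> k \<omega>" for \<omega>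
    have f: "f \<in> borel_measurable (G k)"
    proof -
      have [measurable]: "Measurable.pred (G k) (alive k)" "\<phi> k \<in> borel_measurable (G k)"
        using alive_meas \<phi>_meas k by auto
      show ?thesis unfolding f_def by measurable
    qed
    have f1: "AE \<omega> in M. \<bar>f \<omega>\<bar> \<le> 1"
      using \<phi>1 k by (auto simp: f_def)
    have f': "f \<in> borel_measurable (G (Suc k))" using G_mono[OF f] k by auto
    have S_eq: "S k = (\<lambda>\<omega>. f \<omega> * X (Suc k) \<omega> - f \<omega> * X k \<omega>)"
      by (auto simp: S_def f_def fun_eq_iff algebra_simps)
    show "integrable M (S k)" "expectation (S k) = 0"
      unfolding S_eq using cond[OF f f1] cond[OF f' f1] cond_int[OF f f1] cond_int[OF f' f1] k by auto
  qed
  have R_M [measurable]: "Measurable.pred M (R k)" if "k \<le> N" for k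
    using pred_M[OF R_meas] that by blast
  have R_le: "expectation (\<lambda>\<omega>. \<bar>X k \<omega>\<bar> * of_bool (R k \<omega>)) \<le> expectation (\<lambda>\<omega>. \<bar>X N \<omega>\<bar> * of_bool (R k \<omega>))"
    and R_int: "integrable M (\<lambda>\<omega>. \<bar>X k \<omega>\<bar> * of_bool (R k \<omega>))" "integrable M (\<lambda>\<omega>. \<bar>X N \<omega>\<bar> * of_bool (R k \<omega>))"
    if k: "k \<le> N" for k
  proof -
    \<comment> \<open>The sign turns the modulus into a weight of the kind that \<open>cond\<close>
      accepts.\<close>
    define f where "f \<omega> = sgn (X k \<omega>) * of_bool (R k \<omega>)" for \<omega>
    have f: "f \<in> borel_measurable (G k)"
    proof -
      note [measurable] = R_meas[OF k] X_meas[OF k]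
      show ?thesis unfolding f_def by measurable
    qed
    have f1: "AE \<omega> in M. \<bar>f \<omega>\<bar> \<le> 1" by (auto simp: f_def sgn_real_def)
    have eq: "(\<lambda>\<omega>. \<bar>X k \<omega>\<bar> * of_bool (R k \<omega>)) = (\<lambda>\<omega>. f \<omega> * X k \<omega>)"
      by (auto simp: f_def fun_eq_iff sgn_real_def abs_if)
    show 1: "integrable M (\<lambda>\<omega>. \<bar>X k \<omega>\<bar> * of_bool (R k \<omega>))"
      unfolding eq by (rule cond_int(2)[OF f f1 k])
    show 2: "integrable M (\<lambda>\<omega>. \<bar>X N \<omega>\<bar> * of_bool (R k \<omega>))"
      using k by (intro Bochner_Integration.integrable_bound[OF X_int[OF order_refl]]) auto
    have "expectation (\<lambda>\<omega>. \<bar>X k \<omega>\<bar> * of_bool (R k \<omega>)) = expectation (\<lambda>\<omega>. f \<omega> * X N \<omega>)"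
      unfolding eq by (rule cond[OF f f1 k, symmetric])
    also have "\<dots> \<le> expectation (\<lambda>\<omega>. \<bar>X N \<omega>\<bar> * of_bool (R k \<omega>))"
      using cond_int(1)[OF f f1 k] 2 by (intro integral_mono) (auto simp: f_def sgn_real_def)
    finally show "expectation (\<lambda>\<omega>. \<bar>X k \<omega>\<bar> * of_bool (R k \<omega>)) \<le> expectation (\<lambda>\<omega>. \<bar>X N \<omega>\<bar> * of_bool (R k \<omega>))" .
  qed
  \<comment> \<open>At most one \<open>R k\<close> can hold: it requires all earlier indices to be
    \<open>ok\<close> and itself destroys \<open>ok\<close> at k.\<close>
  have R_disj: "(\<Sum>k\<le>N. of_bool (R k \<omega>)) \<le> (of_bool (W \<omega>) :: real)" if "\<omega> \<in> space M" for \<omega>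
  proof (cases "\<exists>k\<le>N. R k \<omega>")
    case True
    then obtain k where k: "k \<le> N" "R k \<omega>" by blast
    have "R l \<omega> \<longleftrightarrow> l = k" for l
      using k(2) unfolding R_def ok_def by (metis linorder_neqE_nat not_le)
    then have "(\<Sum>k\<le>N. of_bool (R k \<omega>)) = (\<Sum>l\<le>N. if l = k then 1 else (0::real))"
      by (intro sum.cong) auto
    moreover have "W \<omega>" using W[OF that k(1)] k by (auto simp: R_def)
    ultimately show ?thesis using k by simp
  qed auto
  have W_int: "integrable M (\<lambda>\<omega>. \<bar>X N \<omega>\<bar> * of_bool (W \<omega>))"
    by (intro Bochner_Integration.integrable_bound[OF X_int[OF order_refl]]) auto
  have D_int: "integrable M (\<lambda>\<omega>. of_bool (D \<omega>) :: real)"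
    by (intro integrable_const_bound[of _ 1]) auto
  have L_int: "integrable M (\<lambda>\<omega>. \<phi> N \<omega> * of_bool ((\<exists>k\<le>N. \<kappa> < \<xi> k \<omega>) \<and> \<not> W \<omega> \<and> \<not> D \<omega>))"
  proof (intro integrable_const_bound[of _ 1])
    show "AE \<omega> in M. norm (\<phi> N \<omega> * of_bool ((\<exists>k\<le>N. \<kappa> < \<xi> k \<omega>) \<and> \<not> W \<omega> \<and> \<not> D \<omega>)) \<le> 1"
      using \<phi>1 by eventually_elim auto
    have [measurable]: "Measurable.pred M (\<lambda>\<omega>. \<exists>k\<le>N. \<kappa> < \<xi> k \<omega>)"
      by (rule pred_ex_atMost) measurable
    show "(\<lambda>\<omega>. \<phi> N \<omega> * of_bool ((\<exists>k\<le>N. \<kappa> < \<xi> k \<omega>) \<and> \<not> W \<omega> \<and> \<not> D \<omega>)) \<in> borel_measurable M"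
      by measurable
  qed
  have "\<kappa> * expectation (\<lambda>\<omega>. \<phi> N \<omega> * of_bool ((\<exists>k\<le>N. \<kappa> < \<xi> k \<omega>) \<and> \<not> W \<omega> \<and> \<not> D \<omega>))
      = expectation (\<lambda>\<omega>. \<kappa> * (\<phi> N \<omega> * of_bool ((\<exists>k\<le>N. \<kappa> < \<xi> k \<omega>) \<and> \<not> W \<omega> \<and> \<not> D \<omega>)))"
    by simp
  also have "\<dots> \<le> expectation (\<lambda>\<omega>. h \<omega> + \<epsilon> + (\<Sum>k<N. S k \<omega>) + c * of_bool (D \<omega>) + (\<Sum>k\<le>N. \<bar>X k \<omega>\<bar> * of_bool (R k \<omega>)))"
  proof (rule integral_mono_AE)
    show "integrable M (\<lambda>\<omega>. \<kappa> * (\<phi> N \<omega> * of_bool ((\<exists>k\<le>N. \<kappa> < \<xi> k \<omega>) \<and> \<not> W \<omega> \<and> \<not> D \<omega>)))"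
      using L_int by simp
    \<comment> \<open>The deleted simp rules would absorb \<open>of_bool\<close> into the index sets
      of the sums, where linearity of the integral no longer applies termwise.\<close>
    show "integrable M (\<lambda>\<omega>. h \<omega> + \<epsilon> + (\<Sum>k<N. S k \<omega>) + c * of_bool (D \<omega>) + (\<Sum>k\<le>N. \<bar>X k \<omega>\<bar> * of_bool (R k \<omega>)))"
      using h S D_int R_int
      by (auto intro!: Bochner_Integration.integrable_add Bochner_Integration.integrable_sum simp del: sum_mult_of_bool_eq sum_of_bool_mult_eq)
    show "AE \<omega> in M. \<kappa> * (\<phi> N \<omega> * of_bool ((\<exists>k\<le>N. \<kappa> < \<xi> k \<omega>) \<and> \<not> W \<omega> \<and> \<not> D \<omega>))
      \<le> h \<omega> + \<epsilon> + (\<Sum>k<N. S k \<omega>) + c * of_bool (D \<omega>) + (\<Sum>k\<le>N. \<bar>X k \<omega>\<bar> * of_bool (R k \<omega>))"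
      using \<phi> X0 \<xi> h(2) AE_space
    proof eventually_elim
      case (elim \<omega>)
      show ?case
        unfolding S_def R_def alive_def ok_def
        by (rule stopped_transform_bound) (use elim pos W D in auto)
    qed
  qed
  also have "\<dots> = expectation h + \<epsilon> + (\<Sum>k<N. expectation (S k)) + c * expectation (\<lambda>\<omega>. of_bool (D \<omega>))
      + (\<Sum>k\<le>N. expectation (\<lambda>\<omega>. \<bar>X k \<omega>\<bar> * of_bool (R k \<omega>)))"
  proof -
    have "integrable M (\<lambda>\<omega>. \<Sum>k<N. S k \<omega>)" "expectation (\<lambda>\<omega>. \<Sum>k<N. S k \<omega>) = (\<Sum>k<N. expectation (S k))"
      using S(1) by auto
    moreover have "integrable M (\<lambda>\<omega>. \<Sum>k\<le>N. \<bar>X k \<omega>\<bar> * of_bool (R k \<omega>))"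
      "expectation (\<lambda>\<omega>. \<Sum>k\<le>N. \<bar>X k \<omega>\<bar> * of_bool (R k \<omega>))
        = (\<Sum>k\<le>N. expectation (\<lambda>\<omega>. \<bar>X k \<omega>\<bar> * of_bool (R k \<omega>)))"
      using R_int(1) by (auto simp del: sum_mult_of_bool_eq sum_of_bool_mult_eq)
    ultimately show ?thesis
      using h(1) D_int by (simp add: prob_space del: sum_mult_of_bool_eq sum_of_bool_mult_eq)
  qed
  also have "(\<Sum>k<N. expectation (S k)) = 0" using S by simp
  also have "(\<Sum>k\<le>N. expectation (\<lambda>\<omega>. \<bar>X k \<omega>\<bar> * of_bool (R k \<omega>)))
      \<le> (\<Sum>k\<le>N. expectation (\<lambda>\<omega>. \<bar>X N \<omega>\<bar> * of_bool (R k \<omega>)))"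
    using R_le by (intro sum_mono) auto
  also have "\<dots> = expectation (\<lambda>\<omega>. \<Sum>k\<le>N. \<bar>X N \<omega>\<bar> * of_bool (R k \<omega>))"
    using R_int by (simp del: sum_mult_of_bool_eq sum_of_bool_mult_eq)
  also have "\<dots> \<le> expectation (\<lambda>\<omega>. \<bar>X N \<omega>\<bar> * of_bool (W \<omega>))"
  proof (rule integral_mono)
    show "integrable M (\<lambda>\<omega>. \<Sum>k\<le>N. \<bar>X N \<omega>\<bar> * of_bool (R k \<omega>))"
      using R_int by (auto simp del: sum_mult_of_bool_eq sum_of_bool_mult_eq)
    fix \<omega> assume "\<omega> \<in> space M"
    then show "(\<Sum>k\<le>N. \<bar>X N \<omega>\<bar> * of_bool (R k \<omega>)) \<le> \<bar>X N \<omega>\<bar> * of_bool (W \<omega>)"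
      unfolding sum_distrib_left[symmetric] by (intro mult_left_mono R_disj) auto
  qed (rule W_int)
  finally show ?thesis by simp
qed

text \<open>The discrete bound is used with c = m on the grid of level n. First n tends to infinity
  with m and \<epsilon> fixed, which removes \<open>D\<close>; then m tends to infinity, which
  removes the overshoot. The path conditions are phrased on \<open>{0..t}\<close> in the form that
  is verified below for a process killed at a stopping time.\<close>

lemma (in usual_filtered_prob_space) martingale_maximal:
  assumes t: "0 \<le> t" and \<kappa>: "0 \<le> \<kappa>"
    and \<xi>: "adapted F \<xi>" and A: "adapted F A" and X: "martingale P F X" and X0: "AE \<omega> in P. X 0 \<omega> = 0"
    and h: "integrable P h" "AE \<omega> in P. 0 \<le> h \<omega>"
    and \<xi>_path: "AE \<omega> in P. set_borel_measurable borel {0..t} (\<lambda>s. \<xi> s \<omega>)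
      \<and> (\<forall>s\<in>{0..t}. 0 \<le> \<xi> s \<omega>) \<and> (\<exists>C. \<forall>s\<in>{0..t}. \<xi> s \<omega> \<le> C)
      \<and> (\<forall>s. 0 \<le> s \<longrightarrow> s < t \<longrightarrow> continuous (at_right s) (\<lambda>s. \<xi> s \<omega>))"
    and X_path: "AE \<omega> in P. \<exists>C. \<forall>s\<in>{0..t}. \<bar>X s \<omega>\<bar> \<le> C"
    and A_path: "AE \<omega> in P. continuous_on {0..} (\<lambda>s. A s \<omega>) \<and> mono_on {0..} (\<lambda>s. A s \<omega>) \<and> A 0 \<omega> = 0"
    and le: "AE \<omega> in P. \<forall>u\<in>{0..t}. \<xi> u \<omega> \<le> h \<omega> + (LINT s:{0<..u}|stieltjes_measure (\<lambda>s. A s \<omega>). \<xi> s \<omega>) + X u \<omega>"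
  shows "\<kappa> * expectation (\<lambda>\<omega>. exp (- A t \<omega>) * of_bool (\<exists>n. \<exists>k\<le>2 ^ n. \<kappa> < \<xi> (grid t n k) \<omega>)) \<le> expectation h"
proof -
  have adapted_P: "Z s \<in> borel_measurable P" if "adapted F Z" "0 \<le> s" for Z s
    using that measurable_from_subalg[OF subalgebra_F] by (auto simp: adapted_def)
  have X_adapted: "adapted F X" and X_int: "\<And>s. 0 \<le> s \<Longrightarrow> integrable P (X s)"
    using X by (auto simp: martingale_def)
  have [measurable]: "X (grid t n k) \<in> borel_measurable P" "\<xi> (grid t n k) \<in> borel_measurable P"
    "A (grid t n k) \<in> borel_measurable P" "A t \<in> borel_measurable P" "X t \<in> borel_measurable P" for n k
    using t by (auto intro!: adapted_P \<xi> A X_adapted grid_nonneg)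
  have [measurable]: "h \<in> borel_measurable P" using h by auto
  define B where "B n \<omega> \<longleftrightarrow> (\<exists>k\<le>2 ^ n. \<kappa> < \<xi> (grid t n k) \<omega>)" for n \<omega>
  define W' where "W' m n \<omega> \<longleftrightarrow> (\<exists>k\<le>2 ^ n. real m < \<bar>X (grid t n k) \<omega>\<bar>)" for m n :: nat and \<omega>
  \<comment> \<open>The union over all levels keeps the overshoot term independent of the grid while
    n tends to infinity.\<close>
  define W where "W m \<omega> \<longleftrightarrow> (\<exists>n. W' m n \<omega>)" for m \<omega>
  define T where "T n j \<omega> = (\<Sum>k<j. exp (- A (grid t n k) \<omega>) * (X (grid t n (Suc k)) \<omega> - X (grid t n k) \<omega>))" for n j \<omega>
  \<comment> \<open>The event that the pathwise inequality fails by more than \<epsilon> at some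
    grid point of level n.\<close>
  define D where "D \<epsilon> n \<omega> \<longleftrightarrow> (\<exists>j\<le>2 ^ n. h \<omega> + T n j \<omega> + \<epsilon> < exp (- A (grid t n j) \<omega>) * \<xi> (grid t n j) \<omega>)" for \<epsilon> n \<omega>
  have [measurable]: "T n j \<in> borel_measurable P" for n j
    unfolding T_def by measurable
  have [measurable]: "Measurable.pred P (B n)" for n
    unfolding B_def by (rule pred_ex_atMost) measurable
  have [measurable]: "Measurable.pred P (W' m n)" for m n
    unfolding W'_def by (rule pred_ex_atMost) measurable
  have [measurable]: "Measurable.pred P (W m)" for m
    unfolding W_def by measurable
  have [measurable]: "Measurable.pred P (D \<epsilon> n)" for \<epsilon> n
    unfolding D_def by (rule pred_ex_atMost) measurable
  have exp1: "AE \<omega> in P. exp (- A t \<omega>) \<le> 1"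
    using A_path
  proof eventually_elim
    case (elim \<omega>)
    then show ?case using t mono_onD[of "{0..}" "\<lambda>s. A s \<omega>" 0 t] by auto
  qed
  have B_mono: "B n' \<omega>" if "B n \<omega>" "n \<le> n'" for n n' \<omega>
    using that(2,1)
  proof (induction n' rule: dec_induct)
    case (step n')
    then obtain k where "k \<le> 2 ^ n'" "\<kappa> < \<xi> (grid t n' k) \<omega>" by (auto simp: B_def)
    then show ?case unfolding B_def grid_refine[of t n' k] by (intro exI[of _ "2 * k"]) auto
  qed
  have D_ev: "AE \<omega> in P. \<forall>\<^sub>F n in sequentially. \<not> D \<epsilon> n \<omega>" if "0 < \<epsilon>" for \<epsilon>
    using \<xi>_path A_path le X0
  proof eventually_elim
    case (elim \<omega>)
    then obtain C where C: "\<And>s. s \<in> {0..t} \<Longrightarrow> \<xi> s \<omega> \<le> C" by blast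
    have "\<forall>\<^sub>F n in sequentially. \<forall>j \<le> 2 ^ n. exp (- A (grid t n j) \<omega>) * \<xi> (grid t n j) \<omega>
      \<le> h \<omega> + (\<Sum>k<j. exp (- A (grid t n k) \<omega>) * (X (grid t n (Suc k)) \<omega> - X (grid t n k) \<omega>)) + \<epsilon>"
      by (rule eventually_discounted_path_le[where C = C]) (use elim C t that in auto)
    then show ?case by eventually_elim (auto simp: D_def T_def not_less)
  qed
  define E where "E = expectation (\<lambda>\<omega>. exp (- A t \<omega>) * of_bool (\<exists>n. B n \<omega>))"
  \<comment> \<open>The limit in n. Nested grids make \<open>B n\<close> increasing, and almost
    surely \<open>D \<epsilon> n\<close> fails for all large n, so dominated convergence identifies
    the left side.\<close>
  have m_bound: "\<kappa> * expectation (\<lambda>\<omega>. exp (- A t \<omega>) * of_bool ((\<exists>n. B n \<omega>) \<and> \<not> W m \<omega>))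
      \<le> expectation h + \<epsilon> + expectation (\<lambda>\<omega>. \<bar>X t \<omega>\<bar> * of_bool (W m \<omega>))" if \<epsilon>: "0 < \<epsilon>" for \<epsilon> m
  proof (rule tendsto_le[OF sequentially_bot])
    show "(\<lambda>n. \<kappa> * expectation (\<lambda>\<omega>. exp (- A t \<omega>) * of_bool (B n \<omega> \<and> \<not> W m \<omega> \<and> \<not> D \<epsilon> n \<omega>)))
      \<longlonglongrightarrow> \<kappa> * expectation (\<lambda>\<omega>. exp (- A t \<omega>) * of_bool ((\<exists>n. B n \<omega>) \<and> \<not> W m \<omega>))"
    proof (rule tendsto_mult_left, rule integral_dominated_convergence[where w = "\<lambda>_. 1"])
      show "AE \<omega> in P. (\<lambda>n. exp (- A t \<omega>) * of_bool (B n \<omega> \<and> \<not> W m \<omega> \<and> \<not> D \<epsilon> n \<omega>))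
        \<longlonglongrightarrow> exp (- A t \<omega>) * of_bool ((\<exists>n. B n \<omega>) \<and> \<not> W m \<omega>)"
        using D_ev[OF \<epsilon>]
      proof eventually_elim
        case (elim \<omega>)
        have "\<forall>\<^sub>F n in sequentially. B n \<omega> \<longleftrightarrow> (\<exists>n. B n \<omega>)"
        proof (cases "\<exists>n. B n \<omega>")
          case True
          then obtain n where "B n \<omega>" ..
          then have "\<forall>n'\<ge>n. B n' \<omega> \<longleftrightarrow> (\<exists>n. B n \<omega>)" using B_mono by blast
          then show ?thesis unfolding eventually_sequentially by blast
        qed auto
        with elim have "\<forall>\<^sub>F n in sequentially. exp (- A t \<omega>) * of_bool (B n \<omega> \<and> \<not> W m \<omega> \<and> \<not> D \<epsilon> n \<omega>)
            = exp (- A t \<omega>) * of_bool ((\<exists>n. B n \<omega>) \<and> \<not> W m \<omega>)"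
          by eventually_elim auto
        then show ?case by (rule tendsto_eventually)
      qed
      show "AE \<omega> in P. norm (exp (- A t \<omega>) * of_bool (B n \<omega> \<and> \<not> W m \<omega> \<and> \<not> D \<epsilon> n \<omega>)) \<le> 1" for n
        using exp1 by eventually_elim auto
    qed auto
    \<comment> \<open>Since m is fixed here, the factor \<open>real m\<close> does not disturb the
      convergence to 0.\<close>
    have "(\<lambda>n. expectation (\<lambda>\<omega>. of_bool (D \<epsilon> n \<omega>) :: real)) \<longlonglongrightarrow> expectation (\<lambda>\<omega>. 0)"
    proof (rule integral_dominated_convergence[where w = "\<lambda>_. 1"])
      show "AE \<omega> in P. (\<lambda>n. of_bool (D \<epsilon> n \<omega>) :: real) \<longlonglongrightarrow> 0"
        using D_ev[OF \<epsilon>]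
      proof eventually_elim
        case (elim \<omega>)
        then have "\<forall>\<^sub>F n in sequentially. of_bool (D \<epsilon> n \<omega>) = (0 :: real)" by eventually_elim auto
        then show ?case by (rule tendsto_eventually)
      qed
    qed auto
    then have "(\<lambda>n. expectation h + \<epsilon> + real m * expectation (\<lambda>\<omega>. of_bool (D \<epsilon> n \<omega>)) + expectation (\<lambda>\<omega>. \<bar>X t \<omega>\<bar> * of_bool (W m \<omega>)))
      \<longlonglongrightarrow> expectation h + \<epsilon> + real m * expectation (\<lambda>\<omega>. 0) + expectation (\<lambda>\<omega>. \<bar>X t \<omega>\<bar> * of_bool (W m \<omega>))"
      by (intro tendsto_intros)
    then show "(\<lambda>n. expectation h + \<epsilon> + real m * expectation (\<lambda>\<omega>. of_bool (D \<epsilon> n \<omega>)) + expectation (\<lambda>\<omega>. \<bar>X t \<omega>\<bar> * of_bool (W m \<omega>)))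
      \<longlonglongrightarrow> expectation h + \<epsilon> + expectation (\<lambda>\<omega>. \<bar>X t \<omega>\<bar> * of_bool (W m \<omega>))"
      by simp
    show "\<forall>\<^sub>F n in sequentially. \<kappa> * expectation (\<lambda>\<omega>. exp (- A t \<omega>) * of_bool (B n \<omega> \<and> \<not> W m \<omega> \<and> \<not> D \<epsilon> n \<omega>))
      \<le> expectation h + \<epsilon> + real m * expectation (\<lambda>\<omega>. of_bool (D \<epsilon> n \<omega>)) + expectation (\<lambda>\<omega>. \<bar>X t \<omega>\<bar> * of_bool (W m \<omega>))"
    proof (intro always_eventually allI)
      fix n
      let ?d = "grid t n"
      have d: "0 \<le> ?d k" for k using t by (rule grid_nonneg)
      have "\<kappa> * expectation (\<lambda>\<omega>. exp (- A (?d (2 ^ n)) \<omega>) * of_bool ((\<exists>k\<le>2 ^ n. \<kappa> < \<xi> (?d k) \<omega>) \<and> \<not> W m \<omega> \<and> \<not> D \<epsilon> n \<omega>))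
        \<le> expectation h + \<epsilon> + real m * expectation (\<lambda>\<omega>. of_bool (D \<epsilon> n \<omega>)) + expectation (\<lambda>\<omega>. \<bar>X (?d (2 ^ n)) \<omega>\<bar> * of_bool (W m \<omega>))"
      proof (rule discrete_maximal[where G = "\<lambda>k. F (?d k)" and X = "\<lambda>k. X (?d k)" and \<phi> = "\<lambda>k \<omega>. exp (- A (?d k) \<omega>)" and \<xi> = "\<lambda>k. \<xi> (?d k)"])
        show "subalgebra P (F (?d k))" for k
          by (rule subalgebra_F[OF d])
        show "sets (F (?d k)) \<subseteq> sets (F (?d l))" if "k \<le> l" for k l
          using that t by (intro mono_F d grid_mono)
        show "X (?d k) \<in> borel_measurable (F (?d k))" "\<xi> (?d k) \<in> borel_measurable (F (?d k))" for k
          using X_adapted \<xi> d by (auto simp: adapted_def)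
        have [measurable]: "A (?d k) \<in> borel_measurable (F (?d k))" for k
          using A d by (auto simp: adapted_def)
        show "(\<lambda>\<omega>. exp (- A (?d k) \<omega>)) \<in> borel_measurable (F (?d k))" for k
          by measurable
        show "integrable P (X (?d k))" for k using X_int d by blast
        show "AE \<omega> in P. real_cond_exp P (F (?d k)) (X (?d (2 ^ n))) \<omega> = X (?d k) \<omega>" if "k \<le> 2 ^ n" for k
          using X d t that by (auto simp: martingale_def grid_le)
        show "AE \<omega> in P. X (?d 0) \<omega> = 0" using X0 by simp
        show "AE \<omega> in P. exp (- A (?d 0) \<omega>) \<le> 1 \<and> (\<forall>k<2 ^ n. exp (- A (?d (Suc k)) \<omega>) \<le> exp (- A (?d k) \<omega>)) \<and> 0 \<le> exp (- A (?d (2 ^ n)) \<omega>)"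
          using A_path
        proof eventually_elim
          case (elim \<omega>)
          have "A (?d k) \<omega> \<le> A (?d (Suc k)) \<omega>" for k
            using elim t d by (auto intro!: mono_onD[of "{0..}" "\<lambda>s. A s \<omega>"] grid_mono)
          then show ?case using elim by simp
        qed
        show "AE \<omega> in P. \<forall>k\<le>2 ^ n. 0 \<le> \<xi> (?d k) \<omega>"
          using \<xi>_path by eventually_elim (use d t grid_le in auto)
        show "W m \<omega>" if "k \<le> 2 ^ n" "real m < \<bar>X (?d k) \<omega>\<bar>" for k \<omega>
          using that unfolding W_def W'_def by blast
        show "exp (- A (?d j) \<omega>) * \<xi> (?d j) \<omega> \<le> h \<omega> + (\<Sum>k<j. exp (- A (?d k) \<omega>) * (X (?d (Suc k)) \<omega> - X (?d k) \<omega>)) + \<epsilon>"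
          if "j \<le> 2 ^ n" "\<not> D \<epsilon> n \<omega>" for j \<omega>
          using that unfolding D_def T_def by (auto simp: not_less)
      qed (use h \<kappa> \<epsilon> in auto)
      then show "\<kappa> * expectation (\<lambda>\<omega>. exp (- A t \<omega>) * of_bool (B n \<omega> \<and> \<not> W m \<omega> \<and> \<not> D \<epsilon> n \<omega>))
        \<le> expectation h + \<epsilon> + real m * expectation (\<lambda>\<omega>. of_bool (D \<epsilon> n \<omega>)) + expectation (\<lambda>\<omega>. \<bar>X t \<omega>\<bar> * of_bool (W m \<omega>))"
        unfolding B_def grid_last .
    qed
  qed
  have W_ev: "AE \<omega> in P. \<forall>\<^sub>F m in sequentially. \<not> W m \<omega>"
    using X_path
  proof eventually_elim
    case (elim \<omega>)
    then obtain C where C: "\<And>s. s \<in> {0..t} \<Longrightarrow> \<bar>X s \<omega>\<bar> \<le> C" by blast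
    have "\<not> W m \<omega>" if "nat \<lceil>C\<rceil> \<le> m" for m
    proof -
      have "C \<le> real m" using that by linarith
      moreover have "\<bar>X (grid t n k) \<omega>\<bar> \<le> C" if "k \<le> 2 ^ n" for n k
        using that t by (intro C) (simp add: grid_nonneg grid_le)
      ultimately show ?thesis unfolding W_def W'_def by (meson not_less order_trans)
    qed
    then show ?case unfolding eventually_sequentially by blast
  qed
  \<comment> \<open>The limit in m, with \<epsilon> = 1/(m+1) tied to m. A bounded path eventually
    stays out of \<open>W m\<close>, and the overshoot term is dominated by the integrable
    \<open>\<bar>X t \<omega>\<bar>\<close>.\<close>
  have "\<kappa> * E \<le> expectation h + 0 + expectation (\<lambda>\<omega>. 0)"
  proof (rule tendsto_le[OF sequentially_bot])
    show "(\<lambda>m. \<kappa> * expectation (\<lambda>\<omega>. exp (- A t \<omega>) * of_bool ((\<exists>n. B n \<omega>) \<and> \<not> W m \<omega>))) \<longlonglongrightarrow> \<kappa> * E"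
      unfolding E_def
    proof (rule tendsto_mult_left, rule integral_dominated_convergence[where w = "\<lambda>_. 1"])
      show "AE \<omega> in P. (\<lambda>m. exp (- A t \<omega>) * of_bool ((\<exists>n. B n \<omega>) \<and> \<not> W m \<omega>)) \<longlonglongrightarrow> exp (- A t \<omega>) * of_bool (\<exists>n. B n \<omega>)"
        using W_ev
      proof eventually_elim
        case (elim \<omega>)
        then have "\<forall>\<^sub>F m in sequentially. exp (- A t \<omega>) * of_bool ((\<exists>n. B n \<omega>) \<and> \<not> W m \<omega>) = exp (- A t \<omega>) * of_bool (\<exists>n. B n \<omega>)"
          by eventually_elim auto
        then show ?case by (rule tendsto_eventually)
      qed
      show "AE \<omega> in P. norm (exp (- A t \<omega>) * of_bool ((\<exists>n. B n \<omega>) \<and> \<not> W m \<omega>)) \<le> 1" for m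
        using exp1 by eventually_elim auto
    qed auto
    have "(\<lambda>m. expectation (\<lambda>\<omega>. \<bar>X t \<omega>\<bar> * of_bool (W m \<omega>))) \<longlonglongrightarrow> expectation (\<lambda>\<omega>. 0)"
    proof (rule integral_dominated_convergence[where w = "\<lambda>\<omega>. \<bar>X t \<omega>\<bar>"])
      show "AE \<omega> in P. (\<lambda>m. \<bar>X t \<omega>\<bar> * of_bool (W m \<omega>)) \<longlonglongrightarrow> 0"
        using W_ev
      proof eventually_elim
        case (elim \<omega>)
        then have "\<forall>\<^sub>F m in sequentially. \<bar>X t \<omega>\<bar> * of_bool (W m \<omega>) = 0" by eventually_elim auto
        then show ?case by (rule tendsto_eventually)
      qed
    qed (use X_int[OF t] in auto)
    then show "(\<lambda>m. expectation h + inverse (real (Suc m)) + expectation (\<lambda>\<omega>. \<bar>X t \<omega>\<bar> * of_bool (W m \<omega>)))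
      \<longlonglongrightarrow> expectation h + 0 + expectation (\<lambda>\<omega>. 0)"
      by (intro tendsto_add tendsto_const LIMSEQ_inverse_real_of_nat)
    show "\<forall>\<^sub>F m in sequentially. \<kappa> * expectation (\<lambda>\<omega>. exp (- A t \<omega>) * of_bool ((\<exists>n. B n \<omega>) \<and> \<not> W m \<omega>))
      \<le> expectation h + inverse (real (Suc m)) + expectation (\<lambda>\<omega>. \<bar>X t \<omega>\<bar> * of_bool (W m \<omega>))"
      by (intro always_eventually allI m_bound) simp
  qed
  then show ?thesis by (simp add: E_def B_def)
qed

section \<open>Measurable sections and localisation\<close>

lemma measurable_process_section:
  assumes Z: "measurable_process P Z" and \<omega>: "\<omega> \<in> space P"
  shows "set_borel_measurable borel {0..t} (\<lambda>s. Z s \<omega>)"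
proof -
  \<comment> \<open>Joint measurability is assumed for nonnegative times only, so time is first
    clamped by \<open>max 0\<close>.\<close>
  have max0: "(max 0 :: real \<Rightarrow> real) \<in> borel_measurable borel"
    by (intro borel_measurable_continuous_onI continuous_intros)
  have "(\<lambda>s. (max 0 s, \<omega>)) \<in> borel \<rightarrow>\<^sub>M restrict_space borel {0::real..} \<Otimes>\<^sub>M P"
    by (rule measurable_Pair[OF measurable_restrict_space2[OF _ max0] measurable_const[OF \<omega>]]) simp
  from measurable_compose[OF this Z[unfolded measurable_process_def]]
  have *: "(\<lambda>s. Z (max 0 s) \<omega>) \<in> borel_measurable borel"
    by (simp only: prod.case)
  have "(\<lambda>s. indicator {0..t} s *\<^sub>R Z (max 0 s) \<omega>) \<in> borel_measurable borel"
    by (intro borel_measurable_scaleR borel_measurable_indicator *) simp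
  also have "(\<lambda>s. indicator {0..t} s *\<^sub>R Z (max 0 s) \<omega>) = (\<lambda>s. indicator {0..t} s *\<^sub>R Z s \<omega>)"
    by (auto simp: indicator_def fun_eq_iff)
  finally show ?thesis by (simp add: set_borel_measurable_def)
qed

text \<open>Along the localising sequence, M is stopped and \<xi> is killed. Each m then falls under
  the martingale case with the same right side, so the bound survives the limit in m without any
  uniform integrability of M.\<close>

lemma (in usual_filtered_prob_space) local_martingale_maximal:
  assumes t: "0 \<le> t" and \<kappa>: "0 \<le> \<kappa>"
    and \<xi>_meas: "measurable_process P \<xi>" and \<xi>: "adapted F \<xi>" and \<xi>_nonneg: "AE \<omega> in P. \<forall>s\<ge>0. 0 \<le> \<xi> s \<omega>"
    and \<xi>_cadlag: "AE \<omega> in P. cadlag (\<lambda>s. \<xi> s \<omega>)"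
    and A: "adapted F A" and A0: "AE \<omega> in P. A 0 \<omega> = 0"
    and A_path: "AE \<omega> in P. continuous_on {0..} (\<lambda>s. A s \<omega>) \<and> mono_on {0..} (\<lambda>s. A s \<omega>)"
    and M: "local_martingale P F M" and M0: "AE \<omega> in P. M 0 \<omega> = 0"
    and h: "integrable P h" "AE \<omega> in P. 0 \<le> h \<omega>"
    and le: "AE \<omega> in P. \<forall>u\<in>{0..t}. \<xi> u \<omega> \<le> h \<omega> + (LINT s:{0<..u}|stieltjes_measure (\<lambda>s. A s \<omega>). \<xi> s \<omega>) + M u \<omega>"
  shows "\<kappa> * expectation (\<lambda>\<omega>. exp (- A t \<omega>) * of_bool (\<exists>n. \<exists>k\<le>2 ^ n. \<kappa> < \<xi> (grid t n k) \<omega>)) \<le> expectation h"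
proof -
  have M_cadlag: "AE \<omega> in P. cadlag (\<lambda>t. M t \<omega>)" using M by (simp add: local_martingale_def)
  obtain \<tau> where \<tau>: "\<And>m. stopping_time (extended_filtration P F) (\<tau> m)"
    and \<tau>_lim: "AE \<omega> in P. incseq (\<lambda>m. \<tau> m \<omega>) \<and> (\<lambda>m. \<tau> m \<omega>) \<longlonglongrightarrow> \<top>"
    and M_mart: "\<And>m. martingale P F (\<lambda>t \<omega>. stopped M (\<tau> m) t \<omega> - M 0 \<omega>)"
    using M unfolding local_martingale_def by blast
  \<comment> \<open>After \<open>\<tau> m\<close> the inequality for \<open>\<zeta> m\<close> and the stopped martingale reduces to the one for \<open>\<xi>\<close> at
    time \<open>\<tau> m\<close>, because \<open>dA\<close> has no atom there.\<close>
  define \<zeta> where "\<zeta> m s \<omega> = \<xi> s \<omega> * of_bool (ennreal s < \<tau> m \<omega>)" for m s \<omega>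
  have bound: "\<kappa> * expectation (\<lambda>\<omega>. exp (- A t \<omega>) * of_bool (\<exists>n. \<exists>k\<le>2 ^ n. \<kappa> < \<zeta> m (grid t n k) \<omega>)) \<le> expectation h" for m
  proof (rule martingale_maximal[OF t \<kappa> _ A M_mart _ h])
    show "adapted F (\<zeta> m)"
      unfolding adapted_def
    proof safe
      fix s :: real assume s: "0 \<le> s"
      have [measurable]: "\<xi> s \<in> borel_measurable (F s)" using \<xi> s by (simp add: adapted_def)
      have [measurable]: "Measurable.pred (F s) (\<lambda>\<omega>. ennreal s < \<tau> m \<omega>)"
        using stopping_timeD2[OF \<tau>, of "ennreal s" m] s by (simp add: extended_filtration_def)
      show "\<zeta> m s \<in> borel_measurable (F s)" unfolding \<zeta>_def by measurable
    qed
    show "AE \<omega> in P. stopped M (\<tau> m) 0 \<omega> - M 0 \<omega> = 0"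
      by (simp add: stopped_def)
    show "AE \<omega> in P. \<exists>C. \<forall>s\<in>{0..t}. \<bar>stopped M (\<tau> m) s \<omega> - M 0 \<omega>\<bar> \<le> C"
      using M_cadlag
    proof eventually_elim
      case (elim \<omega>)
      obtain C where C: "\<And>s. s \<in> {0..t} \<Longrightarrow> \<bar>M s \<omega>\<bar> \<le> C"
        using bounded_cadlag[OF elim t] by blast
      \<comment> \<open>The stopped path only takes values that M takes at times up to s, so the
        bound for M on \<open>{0..t}\<close> applies.\<close>
      have "\<bar>stopped M (\<tau> m) s \<omega>\<bar> \<le> C" if "s \<in> {0..t}" for s
      proof -
        have "enn2real (min (ennreal s) (\<tau> m \<omega>)) \<le> enn2real (ennreal s)"
          by (intro enn2real_mono) auto
        then show ?thesis unfolding stopped_def using that by (intro C) auto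
      qed
      then have "\<bar>stopped M (\<tau> m) s \<omega> - M 0 \<omega>\<bar> \<le> C + \<bar>M 0 \<omega>\<bar>" if "s \<in> {0..t}" for s
        using that by (intro order_trans[OF abs_triangle_ineq4] add_right_mono) auto
      then show ?case by blast
    qed
    show "AE \<omega> in P. set_borel_measurable borel {0..t} (\<lambda>s. \<zeta> m s \<omega>)
      \<and> (\<forall>s\<in>{0..t}. 0 \<le> \<zeta> m s \<omega>) \<and> (\<exists>C. \<forall>s\<in>{0..t}. \<zeta> m s \<omega> \<le> C)
      \<and> (\<forall>s. 0 \<le> s \<longrightarrow> s < t \<longrightarrow> continuous (at_right s) (\<lambda>s. \<zeta> m s \<omega>))"
      using \<xi>_cadlag \<xi>_nonneg AE_space
    proof eventually_elim
      case (elim \<omega>)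
      obtain C where C: "\<And>s. s \<in> {0..t} \<Longrightarrow> \<bar>\<xi> s \<omega>\<bar> \<le> C"
        using bounded_cadlag[OF elim(1) t] by blast
      have "\<zeta> m s \<omega> \<le> C" if "s \<in> {0..t}" for s
        using C[OF that] by (auto simp: \<zeta>_def)
      moreover have "\<forall>s\<in>{0..t}. 0 \<le> \<zeta> m s \<omega>"
        using elim(2) by (auto simp: \<zeta>_def)
      moreover have "set_borel_measurable borel {0..t} (\<lambda>s. \<zeta> m s \<omega>)"
      proof -
        have [measurable]: "(\<lambda>s. indicator {0..t} s *\<^sub>R \<xi> s \<omega>) \<in> borel_measurable borel"
          using measurable_process_section[OF \<xi>_meas elim(3)] by (simp add: set_borel_measurable_def)
        have "(\<lambda>s. (indicator {0..t} s *\<^sub>R \<xi> s \<omega>) * of_bool (ennreal s < \<tau> m \<omega>)) \<in> borel_measurable borel"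
          by measurable
        then show ?thesis by (simp add: set_borel_measurable_def \<zeta>_def mult.assoc)
      qed
      \<comment> \<open>The strict inequality in the definition of \<open>\<zeta>\<close> matters:
        the times before \<open>\<tau> m\<close> are open to the right, and at
        \<open>\<tau> m\<close> itself the process is already 0.\<close>
      moreover have "continuous (at_right s) (\<lambda>s. \<zeta> m s \<omega>)" if "0 \<le> s" for s
      proof (cases "ennreal s < \<tau> m \<omega>")
        case True
        have "(ennreal \<longlongrightarrow> ennreal s) (at_right s)"
          by (intro tendsto_ennrealI tendsto_ident_at)
        then have "\<forall>\<^sub>F s' in at_right s. ennreal s' < \<tau> m \<omega>"
          using True by (rule order_tendstoD)
        then have "\<forall>\<^sub>F s' in at_right s. \<xi> s' \<omega> = \<zeta> m s' \<omega>"
          by eventually_elim (simp add: \<zeta>_def)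
        moreover have "((\<lambda>s. \<xi> s \<omega>) \<longlongrightarrow> \<zeta> m s \<omega>) (at_right s)"
          using elim(1) that True by (simp add: cadlag_def continuous_within \<zeta>_def)
        ultimately show ?thesis
          unfolding continuous_within by (rule Lim_transform_eventually[rotated])
      next
        case False
        have "\<forall>\<^sub>F s' in at_right s. \<zeta> m s' \<omega> = 0"
          using eventually_at_right_less[of s]
        proof eventually_elim
          case (elim s')
          then have "\<not> ennreal s' < \<tau> m \<omega>"
            using False by (meson ennreal_leI less_imp_le not_less order_trans)
          then show ?case by (simp add: \<zeta>_def)
        qed
        then show ?thesis
          using False by (simp add: continuous_within \<zeta>_def tendsto_eventually)
      qed
      ultimately show ?case by blast
    qed
    show "AE \<omega> in P. continuous_on {0..} (\<lambda>s. A s \<omega>) \<and> mono_on {0..} (\<lambda>s. A s \<omega>) \<and> A 0 \<omega> = 0"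
      using A_path A0 by eventually_elim simp
    show "AE \<omega> in P. \<forall>u\<in>{0..t}. \<zeta> m u \<omega>
      \<le> h \<omega> + (LINT s:{0<..u}|stieltjes_measure (\<lambda>s. A s \<omega>). \<zeta> m s \<omega>) + (stopped M (\<tau> m) u \<omega> - M 0 \<omega>)"
      using le A_path M0 \<xi>_nonneg AE_space
    proof eventually_elim
      case (elim \<omega>)
      let ?\<mu> = "stieltjes_measure (\<lambda>s. A s \<omega>)"
      have [measurable]: "(\<lambda>s. indicator {0..t} s *\<^sub>R \<xi> s \<omega>) \<in> borel_measurable borel"
        using measurable_process_section[OF \<xi>_meas elim(5)] by (simp add: set_borel_measurable_def)
      show ?case
      proof
        fix u assume u: "u \<in> {0..t}"
        show "\<zeta> m u \<omega> \<le> h \<omega> + (LINT s:{0<..u}|?\<mu>. \<zeta> m s \<omega>) + (stopped M (\<tau> m) u \<omega> - M 0 \<omega>)"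
        proof (cases "ennreal u < \<tau> m \<omega>")
          case True
          have "(LINT s:{0<..u}|?\<mu>. \<zeta> m s \<omega>) = (LINT s:{0<..u}|?\<mu>. \<xi> s \<omega>)"
          proof (rule set_lebesgue_integral_cong)
            show "\<forall>s. s \<in> {0<..u} \<longrightarrow> \<zeta> m s \<omega> = \<xi> s \<omega>"
              using order.strict_trans1[OF ennreal_leI True] by (auto simp: \<zeta>_def)
          qed simp
          moreover have "stopped M (\<tau> m) u \<omega> = M u \<omega>"
            using True u by (simp add: stopped_def min_absorb1 less_imp_le)
          moreover have "\<zeta> m u \<omega> = \<xi> u \<omega>" using True by (simp add: \<zeta>_def)
          ultimately show ?thesis using elim(1,3) u by simp
        next
          case False
          define r where "r = enn2real (\<tau> m \<omega>)"
          have \<tau>r: "\<tau> m \<omega> = ennreal r"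
            using False order.strict_trans1[of "\<tau> m \<omega>" "ennreal u" \<top>] by (simp add: r_def not_less)
          have r0: "0 \<le> r" by (simp add: r_def)
          have "ennreal r \<le> ennreal u" using False \<tau>r by (simp add: not_less)
          then have r: "0 \<le> r" "r \<le> u" using r0 u by simp_all
          have "AE s in ?\<mu>. s \<noteq> r"
            using emeasure_stieltjes_measure(2)[of "\<lambda>s. A s \<omega>" r r] elim(2) r
            by (intro AE_I[of _ _ "{r}"]) auto
          then have "AE s in ?\<mu>. indicator {0<..u} s *\<^sub>R \<zeta> m s \<omega> = indicator {0<..r} s *\<^sub>R \<xi> s \<omega>"
            by eventually_elim (use r in \<open>auto simp: \<zeta>_def \<tau>r indicator_def ennreal_less_iff\<close>)
          moreover have "(\<lambda>s. indicator {0<..u} s *\<^sub>R \<zeta> m s \<omega>) \<in> borel_measurable ?\<mu>"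
          proof -
            have "(\<lambda>s. indicator {0<..u} s * (indicator {0..t} s *\<^sub>R \<xi> s \<omega>) * of_bool (ennreal s < \<tau> m \<omega>)) \<in> borel_measurable borel"
              by measurable
            also have "(\<lambda>s. indicator {0<..u} s * (indicator {0..t} s *\<^sub>R \<xi> s \<omega>) * of_bool (ennreal s < \<tau> m \<omega>))
              = (\<lambda>s. indicator {0<..u} s *\<^sub>R \<zeta> m s \<omega>)"
              using u by (auto simp: \<zeta>_def indicator_def fun_eq_iff)
            finally show ?thesis by (simp add: measurable_cong_sets[of ?\<mu> borel])
          qed
          moreover have "(\<lambda>s. indicator {0<..r} s *\<^sub>R \<xi> s \<omega>) \<in> borel_measurable ?\<mu>"
          proof -
            have "(\<lambda>s. indicator {0<..r} s * (indicator {0..t} s *\<^sub>R \<xi> s \<omega>)) \<in> borel_measurable borel"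
              by measurable
            also have "(\<lambda>s. indicator {0<..r} s * (indicator {0..t} s *\<^sub>R \<xi> s \<omega>)) = (\<lambda>s. indicator {0<..r} s *\<^sub>R \<xi> s \<omega>)"
              using u r by (auto simp: indicator_def fun_eq_iff)
            finally show ?thesis by (simp add: measurable_cong_sets[of ?\<mu> borel])
          qed
          ultimately have "(LINT s:{0<..u}|?\<mu>. \<zeta> m s \<omega>) = (LINT s:{0<..r}|?\<mu>. \<xi> s \<omega>)"
            unfolding set_lebesgue_integral_def by (intro integral_cong_AE)
          moreover have "stopped M (\<tau> m) u \<omega> = M r \<omega>"
            using r by (simp add: stopped_def \<tau>r min_absorb2 ennreal_leI)
          moreover have "\<zeta> m u \<omega> = 0" using False by (simp add: \<zeta>_def)
          \<comment> \<open>Nonnegativity of \<xi> at time r makes the right side of its inequality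
            nonnegative, which is all that the killed process requires after r.\<close>
          moreover have "0 \<le> h \<omega> + (LINT s:{0<..r}|?\<mu>. \<xi> s \<omega>) + M r \<omega>"
            using elim(1,4) r u by (meson atLeastAtMost_iff order_trans)
          ultimately show ?thesis using elim(3) by simp
        qed
      qed
    qed
  qed
  have adapted_P: "Z s \<in> borel_measurable P" if "adapted F Z" "0 \<le> s" for Z s
    using that measurable_from_subalg[OF subalgebra_F] by (auto simp: adapted_def)
  have [measurable]: "A t \<in> borel_measurable P" "\<xi> (grid t n k) \<in> borel_measurable P" for n k
    using t by (auto intro!: adapted_P \<xi> A grid_nonneg)
  have \<tau>_meas: "Measurable.pred P (\<lambda>\<omega>. ennreal s < \<tau> m \<omega>)" if "0 \<le> s" for s m
  proof -
    have "Measurable.pred (F s) (\<lambda>\<omega>. ennreal s < \<tau> m \<omega>)"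
      using stopping_timeD2[OF \<tau>, of "ennreal s" m] that by (simp add: extended_filtration_def)
    then show ?thesis using measurable_from_subalg[OF subalgebra_F[OF that]] by blast
  qed
  have [measurable]: "\<zeta> m (grid t n k) \<in> borel_measurable P" for m n k
  proof -
    note [measurable] = \<tau>_meas[OF grid_nonneg[OF t]]
    show ?thesis unfolding \<zeta>_def by measurable
  qed
  define B where "B n \<omega> \<longleftrightarrow> (\<exists>k\<le>2 ^ n. \<kappa> < \<xi> (grid t n k) \<omega>)" for n \<omega>
  define B' where "B' m n \<omega> \<longleftrightarrow> (\<exists>k\<le>2 ^ n. \<kappa> < \<zeta> m (grid t n k) \<omega>)" for m n \<omega>
  have [measurable]: "Measurable.pred P (B n)" for n
    unfolding B_def by (rule pred_ex_atMost) measurable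
  have [measurable]: "Measurable.pred P (B' m n)" for m n
    unfolding B'_def by (rule pred_ex_atMost) measurable
  have "(\<lambda>m. \<kappa> * expectation (\<lambda>\<omega>. exp (- A t \<omega>) * of_bool (\<exists>n. B' m n \<omega>)))
    \<longlonglongrightarrow> \<kappa> * expectation (\<lambda>\<omega>. exp (- A t \<omega>) * of_bool (\<exists>n. B n \<omega>))"
  proof (rule tendsto_mult_left, rule integral_dominated_convergence[where w = "\<lambda>_. 1"])
    show "AE \<omega> in P. (\<lambda>m. exp (- A t \<omega>) * of_bool (\<exists>n. B' m n \<omega>)) \<longlonglongrightarrow> exp (- A t \<omega>) * of_bool (\<exists>n. B n \<omega>)"
      using \<tau>_lim
    proof eventually_elim
      case (elim \<omega>)
      \<comment> \<open>Once \<open>\<tau> m\<close> lies beyond t, killing changes no grid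
        value.\<close>
      then have "\<forall>\<^sub>F m in sequentially. ennreal t < \<tau> m \<omega>"
        by (intro order_tendstoD(1)[of _ \<top>]) auto
      then have "\<forall>\<^sub>F m in sequentially. exp (- A t \<omega>) * of_bool (\<exists>n. B' m n \<omega>) = exp (- A t \<omega>) * of_bool (\<exists>n. B n \<omega>)"
      proof eventually_elim
        case (elim m)
        have "ennreal (grid t n k) < \<tau> m \<omega>" if "k \<le> 2 ^ n" for n k
          using elim grid_le[OF t that] by (meson ennreal_leI order.strict_trans1)
        then have "B' m n \<omega> \<longleftrightarrow> B n \<omega>" for n
          unfolding B_def B'_def \<zeta>_def by auto
        then show ?case by simp
      qed
      then show ?case by (rule tendsto_eventually)
    qed
    show "AE \<omega> in P. norm (exp (- A t \<omega>) * of_bool (\<exists>n. B' m n \<omega>)) \<le> 1" for m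
      using A_path A0
    proof eventually_elim
      case (elim \<omega>)
      then show ?case using t mono_onD[of "{0..}" "\<lambda>s. A s \<omega>" 0 t] by auto
    qed
  qed auto
  then have "\<kappa> * expectation (\<lambda>\<omega>. exp (- A t \<omega>) * of_bool (\<exists>n. B n \<omega>)) \<le> expectation h"
    by (rule LIMSEQ_le_const2) (use bound in \<open>simp add: B'_def\<close>)
  then show ?thesis by (simp add: B_def)
qed

section \<open>From tails to moments\<close>

text \<open>Layer-cake integration in the variable y = \<kappa>^q: the tail is bounded by 1 for y <
  a and by K y^(-r) for larger y, with r = p/q > 1. The two pieces add up to a + a/(r-1) = a
  p/(p-q).\<close>

lemma (in prob_space) powr_moment_le_of_tail_bound:
  fixes Z :: "'a \<Rightarrow> real"
  assumes Z [measurable]: "Z \<in> borel_measurable M" and Z0: "\<And>\<omega>. 0 \<le> Z \<omega>"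
    and K: "0 < K" and q: "0 < q" "q < p"
    and tail: "\<And>\<kappa>. 0 < \<kappa> \<Longrightarrow> prob {\<omega> \<in> space M. \<kappa> < Z \<omega>} \<le> K * \<kappa> powr - p"
  shows "(\<integral>\<^sup>+\<omega>. ennreal (Z \<omega> powr q) \<partial>M) \<le> ennreal (p / (p - q) * K powr (q / p))"
proof -
  interpret pair_sigma_finite M lborel ..
  define r where "r = p / q"
  have r: "1 < r" using q by (simp add: r_def)
  \<comment> \<open>The level at which the tail bound K y^(-r) equals the trivial bound 1.\<close>
  define a where "a = K powr (1 / r)"
  have a: "0 < a" using K by (simp add: a_def)
  have aK: "K * a powr - r = 1"
    using K r by (simp add: a_def powr_powr powr_minus)
  have [measurable]: "(\<lambda>\<omega>. Z \<omega> powr q) \<in> borel_measurable M" by measurable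
  have "(\<integral>\<^sup>+\<omega>. ennreal (Z \<omega> powr q) \<partial>M)
      = (\<integral>\<^sup>+\<omega>. (\<integral>\<^sup>+y. (if 0 < y \<and> y < Z \<omega> powr q then 1 else 0) \<partial>lborel) \<partial>M)"
  proof (intro nn_integral_cong)
    fix \<omega>
    have "(\<integral>\<^sup>+y. (if 0 < y \<and> y < Z \<omega> powr q then 1 else 0) \<partial>lborel)
        = (\<integral>\<^sup>+y. indicator {0<..<Z \<omega> powr q} y \<partial>lborel)"
      by (intro nn_integral_cong) (auto simp: indicator_def)
    then show "ennreal (Z \<omega> powr q) = (\<integral>\<^sup>+y. (if 0 < y \<and> y < Z \<omega> powr q then 1 else 0) \<partial>lborel)"
      by simp
  qed
  also have "\<dots> = (\<integral>\<^sup>+y. (\<integral>\<^sup>+\<omega>. (if 0 < y \<and> y < Z \<omega> powr q then 1 else 0) \<partial>M) \<partial>lborel)"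
    by (rule Fubini'[symmetric]) (simp add: case_prod_beta)
  also have "\<dots> \<le> (\<integral>\<^sup>+y. indicator {0<..<a} y + ennreal (K * y powr - r) * indicator {a..} y \<partial>lborel)"
  proof (intro nn_integral_mono)
    fix y :: real
    show "(\<integral>\<^sup>+\<omega>. (if 0 < y \<and> y < Z \<omega> powr q then 1 else 0) \<partial>M)
        \<le> indicator {0<..<a} y + ennreal (K * y powr - r) * indicator {a..} y"
    proof (cases "0 < y")
      case True
      define \<kappa> where "\<kappa> = y powr (1 / q)"
      have \<kappa>: "0 < \<kappa>" "\<kappa> powr q = y" "\<kappa> powr - p = y powr - r"
        using True q by (auto simp: \<kappa>_def powr_powr r_def)
      have iff: "y < Z \<omega> powr q \<longleftrightarrow> \<kappa> < Z \<omega>" for \<omega>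
        using \<kappa> q Z0[of \<omega>] by (metis less_imp_le not_le powr_less_mono2 powr_mono2)
      have "(\<integral>\<^sup>+\<omega>. (if 0 < y \<and> y < Z \<omega> powr q then 1 else 0) \<partial>M)
          = (\<integral>\<^sup>+\<omega>. indicator {\<omega> \<in> space M. \<kappa> < Z \<omega>} \<omega> \<partial>M)"
        using True by (intro nn_integral_cong) (auto simp: indicator_def iff)
      also have "\<dots> = ennreal (prob {\<omega> \<in> space M. \<kappa> < Z \<omega>})"
        by (simp add: emeasure_eq_measure)
      finally have eq: "(\<integral>\<^sup>+\<omega>. (if 0 < y \<and> y < Z \<omega> powr q then 1 else 0) \<partial>M) = ennreal (prob {\<omega> \<in> space M. \<kappa> < Z \<omega>})" .
      show ?thesis
      proof (cases "y < a")
        case True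
        then show ?thesis using \<open>0 < y\<close> unfolding eq by simp
      next
        case False
        then show ?thesis using tail[OF \<kappa>(1)] unfolding eq \<kappa>(3) by (simp add: ennreal_leI)
      qed
    qed simp
  qed
  also have "\<dots> = (\<integral>\<^sup>+y. indicator {0<..<a} y \<partial>lborel) + (\<integral>\<^sup>+y. ennreal (K * y powr - r) * indicator {a..} y \<partial>lborel)"
    by (rule nn_integral_add) auto
  also have "(\<integral>\<^sup>+y. indicator {0<..<a} y \<partial>lborel) = ennreal a"
    using a by simp
  also have "(\<integral>\<^sup>+y. ennreal (K * y powr - r) * indicator {a..} y \<partial>lborel)
      = ennreal (0 - (- K / (r - 1) * a powr (1 - r)))"
  proof (rule nn_integral_FTC_atLeast)
    show "(\<lambda>y. K * y powr - r) \<in> borel_measurable borel" by measurable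
    fix y assume "a \<le> y"
    then have y: "0 < y" using a by simp
    show "((\<lambda>y. - K / (r - 1) * y powr (1 - r)) has_real_derivative K * y powr - r) (at y)"
    proof -
      have "- K / (r - 1) * ((1 - r) * y powr (1 - r - 1)) = K * y powr - r"
        using r by (simp add: divide_simps) (simp add: algebra_simps)
      then show ?thesis
        using DERIV_cmult[OF has_real_derivative_powr[OF y, of "1 - r"], of "- K / (r - 1)"] by simp
    qed
    show "0 \<le> K * y powr - r" using K by simp
  next
    have "((\<lambda>y. y powr (1 - r)) \<longlongrightarrow> 0) at_top"
      using r by (intro tendsto_neg_powr filterlim_ident) auto
    then show "((\<lambda>y. - K / (r - 1) * y powr (1 - r)) \<longlongrightarrow> 0) at_top"
      by (rule tendsto_mult_right_zero)
  qed
  also have "0 - (- K / (r - 1) * a powr (1 - r)) = a / (r - 1)"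
  proof -
    have "K * a powr (1 - r) = a"
      using aK a K by (simp add: powr_diff powr_minus field_simps)
    then show ?thesis by simp
  qed
  also have "ennreal a + ennreal (a / (r - 1)) = ennreal (a + a / (r - 1))"
    using a r by (simp add: ennreal_plus)
  also have "a + a / (r - 1) = p / (p - q) * K powr (q / p)"
    using q r by (simp add: a_def r_def field_simps)
  finally show ?thesis .
qed

text \<open>Young's inequality for the factors \<open>\<kappa> e\<^sup>-\<^sup>A / \<alpha>\<close> and \<open>e\<^bsup>p A / (1 - p)\<^esup> / \<beta>\<close>, whose weighted
  product no longer contains \<open>A\<close>.\<close>

lemma (in prob_space) tail_bound_of_exp_weighted:
  assumes [measurable]: "A \<in> borel_measurable M" "Measurable.pred M B"
    and p: "0 < p" "p < 1" and \<kappa>: "0 < \<kappa>" and \<alpha>: "0 < \<alpha>"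
    and \<beta>_int: "integrable M (\<lambda>\<omega>. exp (p * A \<omega> / (1 - p)))"
    and w_int: "integrable M (\<lambda>\<omega>. exp (- A \<omega>) * of_bool (B \<omega>))"
    and le: "\<kappa> * expectation (\<lambda>\<omega>. exp (- A \<omega>) * of_bool (B \<omega>)) \<le> \<alpha>"
  defines "\<beta> \<equiv> expectation (\<lambda>\<omega>. exp (p * A \<omega> / (1 - p)))"
  assumes \<beta>: "0 < \<beta>"
  shows "prob {\<omega> \<in> space M. B \<omega>} \<le> \<alpha> powr p * \<beta> powr (1 - p) * \<kappa> powr - p"
proof -
  \<comment> \<open>The reciprocal of the weighted product u^p v^(1-p) formed below.\<close>
  define c where "c = \<alpha> powr p * \<beta> powr (1 - p) * \<kappa> powr - p"
  have c: "0 < c" using \<alpha> \<beta> \<kappa> by (simp add: c_def)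
  have pt: "of_bool (B \<omega>) \<le> c * (p * (\<kappa> / \<alpha>) * (exp (- A \<omega>) * of_bool (B \<omega>)) + (1 - p) / \<beta> * exp (p * A \<omega> / (1 - p)))" for \<omega>
  proof (cases "B \<omega>")
    case True
    define u where "u = \<kappa> * exp (- A \<omega>) / \<alpha>"
    define v where "v = exp (p * A \<omega> / (1 - p)) / \<beta>"
    have uv: "0 < u" "0 < v" using \<kappa> \<alpha> \<beta> by (auto simp: u_def v_def)
    have "u powr p = \<kappa> powr p * exp (- (p * A \<omega>)) / \<alpha> powr p"
      using \<kappa> \<alpha> by (simp add: u_def powr_mult powr_divide exp_powr_real mult.commute)
    moreover have "v powr (1 - p) = exp (p * A \<omega>) / \<beta> powr (1 - p)"
      using p \<beta> by (simp add: v_def powr_divide exp_powr_real)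
    \<comment> \<open>The exponent p/(1-p) is what makes the two exponentials cancel here.\<close>
    ultimately have "u powr p * v powr (1 - p) = \<kappa> powr p / (\<alpha> powr p * \<beta> powr (1 - p))"
      by (simp add: exp_minus)
    then have "c * (u powr p * v powr (1 - p)) = 1"
      using \<kappa> \<alpha> \<beta> by (simp add: c_def powr_minus)
    moreover have "u powr p * v powr (1 - p) \<le> p * u + (1 - p) * v"
      using p uv by (intro Youngs_inequality_0) auto
    ultimately have "1 \<le> c * (p * u + (1 - p) * v)"
      using c by (metis less_imp_le mult_left_mono)
    then show ?thesis using True by (simp add: u_def v_def mult.assoc)
  next
    case False
    then show ?thesis using c p \<beta> by simp
  qed
  have "prob {\<omega> \<in> space M. B \<omega>} = expectation (\<lambda>\<omega>. of_bool (B \<omega>))"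
  proof -
    have "expectation (\<lambda>\<omega>. of_bool (B \<omega>)) = expectation (indicat_real {\<omega> \<in> space M. B \<omega>})"
      by (intro Bochner_Integration.integral_cong) (auto simp: indicator_def)
    then show ?thesis by simp
  qed
  also have "\<dots> \<le> expectation (\<lambda>\<omega>. c * (p * (\<kappa> / \<alpha>) * (exp (- A \<omega>) * of_bool (B \<omega>)) + (1 - p) / \<beta> * exp (p * A \<omega> / (1 - p))))"
  proof (rule integral_mono)
    show "integrable M (\<lambda>\<omega>. of_bool (B \<omega>) :: real)"
      by (intro integrable_const_bound[of _ 1]) auto
  qed (use \<beta>_int w_int pt in \<open>auto intro!: integrable_mult_right Bochner_Integration.integrable_add\<close>)
  also have "\<dots> = c * (p * (\<kappa> / \<alpha>) * expectation (\<lambda>\<omega>. exp (- A \<omega>) * of_bool (B \<omega>)) + (1 - p) / \<beta> * \<beta>)"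
    using \<beta>_int w_int by (simp add: \<beta>_def)
  \<comment> \<open>After normalisation by \<alpha> and \<beta> the two factors have mean at most 1
    and equal to 1, and the weights p and 1-p add up to 1.\<close>
  also have "\<dots> \<le> c * (p * 1 + (1 - p))"
  proof -
    have "(\<kappa> / \<alpha>) * expectation (\<lambda>\<omega>. exp (- A \<omega>) * of_bool (B \<omega>)) \<le> 1"
      using le \<alpha> by (simp add: field_simps)
    then have "p * ((\<kappa> / \<alpha>) * expectation (\<lambda>\<omega>. exp (- A \<omega>) * of_bool (B \<omega>))) \<le> p * 1"
      using p by (intro mult_left_mono) auto
    then show ?thesis using c \<beta> by (intro mult_left_mono) (auto simp: mult.assoc)
  qed
  finally show ?thesis by (simp add: c_def)
qed

section \<open>Extended powers, measurability and the supremum along grids\<close>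

lemma ennreal_powr_le:
  assumes "x \<le> ennreal b" "0 \<le> b" "0 \<le> r"
  shows "ennreal_powr x r \<le> ennreal (b powr r)"
proof -
  have "x \<noteq> \<top>" using assms(1) by (metis ennreal_neq_top top.extremum_uniqueI)
  moreover have "enn2real x \<le> b"
    using assms by (metis enn2real_leI)
  ultimately show ?thesis
    using assms by (auto simp: ennreal_powr_def intro!: ennreal_leI powr_mono2)
qed

lemma measurable_process_nn_integral:
  assumes Z: "measurable_process P Z"
  shows "(\<lambda>\<omega>. \<integral>\<^sup>+s\<in>{0..t}. ennreal (Z s \<omega>) \<partial>lborel) \<in> borel_measurable P"
proof -
  have max0: "max 0 \<in> borel \<rightarrow>\<^sub>M restrict_space borel {0::real..}"
    by (rule measurable_restrict_space2) (auto intro!: borel_measurable_continuous_onI continuous_intros)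
  have "(\<lambda>x. (max 0 (snd x), fst x)) \<in> P \<Otimes>\<^sub>M lborel \<rightarrow>\<^sub>M restrict_space borel {0::real..} \<Otimes>\<^sub>M P"
    by (intro measurable_Pair measurable_compose[OF _ max0] measurable_fst measurable_compose[OF measurable_snd]) simp
  from measurable_compose[OF this Z[unfolded measurable_process_def]]
  have [measurable]: "(\<lambda>x. Z (max 0 (snd x)) (fst x)) \<in> borel_measurable (P \<Otimes>\<^sub>M lborel)"
    by simp
  have "(\<lambda>\<omega>. \<integral>\<^sup>+s. ennreal (Z (max 0 s) \<omega>) * indicator {0..t} s \<partial>lborel) \<in> borel_measurable P"
    by (intro lborel.borel_measurable_nn_integral) (simp add: case_prod_beta)
  moreover have "(\<integral>\<^sup>+s. ennreal (Z (max 0 s) \<omega>) * indicator {0..t} s \<partial>lborel) = (\<integral>\<^sup>+s\<in>{0..t}. ennreal (Z s \<omega>) \<partial>lborel)" for \<omega>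
    by (intro nn_integral_cong) (auto simp: indicator_def)
  ultimately show ?thesis by simp
qed

text \<open>Right continuity makes \<open>x s\<close> the limit of the values at the roundings of s,
  all of which are grid values. The supremum thus becomes countable, and hence measurable for a
  process.\<close>

lemma SUP_grid:
  fixes x :: "real \<Rightarrow> real"
  assumes t: "0 \<le> t" and x: "\<And>s. 0 \<le> s \<Longrightarrow> s < t \<Longrightarrow> continuous (at_right s) x"
  shows "(\<Squnion>s\<in>{0..t}. ennreal (x s)) = (\<Squnion>n. \<Squnion>k\<in>{..2 ^ n}. ennreal (x (grid t n k)))" (is "?S = ?Z")
proof (rule antisym)
  have grid_le_Z: "ennreal (x (grid t n k)) \<le> ?Z" if "k \<le> 2 ^ n" for n k
    using that by (intro SUP_upper2[of n] SUP_upper2[of k]) auto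
  show "?S \<le> ?Z"
  proof (rule SUP_least)
    fix s assume s: "s \<in> {0..t}"
    show "ennreal (x s) \<le> ?Z"
    proof (cases "s = 0")
      case True
      then show ?thesis using grid_le_Z[of 0 0] by simp
    next
      case False
      then have s: "0 < s" "s \<le> t" using s by auto
      have "(\<lambda>n. ennreal (x (grid_ceiling t n s))) \<longlonglongrightarrow> ennreal (x s)"
        using s x by (intro tendsto_ennrealI grid_ceiling_tendsto_right_cont)
      moreover have "ennreal (x (grid_ceiling t n s)) \<le> ?Z" for n
        using grid_ceiling_eq_grid[OF s, of n] grid_le_Z by metis
      ultimately show ?thesis by (intro LIMSEQ_le_const2) auto
    qed
  qed
  show "?Z \<le> ?S"
    using t by (intro SUP_least SUP_upper) (auto simp: grid_nonneg grid_le)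
qed

section \<open>The moment bound\<close>

theorem lemma3p8:
  fixes P :: "'a measure" and F :: "real \<Rightarrow> 'a measure"
    and \<xi> \<eta> A M :: "real \<Rightarrow> 'a \<Rightarrow> real"
    and p q t :: real
  assumes "usual_filtered_prob_space P F"
    and "measurable_process P \<xi>" and "adapted F \<xi>" and "AE \<omega> in P. \<forall>s\<ge>0. 0 \<le> \<xi> s \<omega>"
    and "measurable_process P \<eta>" and "adapted F \<eta>" and "AE \<omega> in P. \<forall>s\<ge>0. 0 \<le> \<eta> s \<omega>"
    and "adapted F A" and "AE \<omega> in P. A 0 \<omega> = 0"
    and "AE \<omega> in P. continuous_on {0..} (\<lambda>s. A s \<omega>) \<and> mono_on {0..} (\<lambda>s. A s \<omega>)"
    and "local_martingale P F M" and "AE \<omega> in P. M 0 \<omega> = 0"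
    and "AE \<omega> in P. cadlag (\<lambda>s. \<xi> s \<omega>)"
    and "AE \<omega> in P. \<forall>u\<ge>0. ereal (\<xi> u \<omega>) \<le>
           enn2ereal (ennreal (\<xi> 0 \<omega>)
             + (\<integral>\<^sup>+s\<in>{0..u}. ennreal (\<eta> s \<omega>) \<partial>lborel)
             + (\<integral>\<^sup>+s\<in>{0..u}. ennreal (\<xi> s \<omega>) \<partial>stieltjes_measure (\<lambda>s. A s \<omega>)))
           + ereal (M u \<omega>)"
    and "0 < q" and "q < p" and "p < 1" and "0 \<le> t"
  shows "ennreal_powr (\<integral>\<^sup>+\<omega>. ennreal_powr (\<Squnion>s\<in>{0..t}. ennreal (\<xi> s \<omega>)) q \<partial>P) (1 / q)
    \<le> ennreal ((p / (p - q)) powr (1 / q))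
      * ennreal_powr (\<integral>\<^sup>+\<omega>. ennreal (exp (p * A t \<omega> / (1 - p))) \<partial>P) ((1 - p) / p)
      * (\<integral>\<^sup>+\<omega>. ennreal (\<xi> 0 \<omega>) + (\<integral>\<^sup>+s\<in>{0..t}. ennreal (\<eta> s \<omega>) \<partial>lborel) \<partial>P)"
proof -
  interpret usual_filtered_prob_space P F by fact
  note \<xi>_meas = assms(2) and \<xi> = assms(3) and \<xi>_nonneg = assms(4) and \<eta>_meas = assms(5)
    and A = assms(8) and A0 = assms(9) and A_path = assms(10) and \<xi>_cadlag = assms(13) and t = \<open>0 \<le> t\<close>
  have p: "0 < p" "p < 1" using \<open>0 < q\<close> \<open>q < p\<close> \<open>p < 1\<close> by auto
  define c where "c = (p / (p - q)) powr (1 / q)"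
  have c: "0 < c" using p \<open>q < p\<close> by (simp add: c_def)
  define S where "S \<omega> = (\<Squnion>s\<in>{0..t}. ennreal (\<xi> s \<omega>))" for \<omega>
  \<comment> \<open>The countable substitute for \<open>S\<close>: it is measurable, and almost
    surely equal to \<open>S\<close> by \<open>SUP_grid\<close>.\<close>
  define Z where "Z \<omega> = (\<Squnion>n. \<Squnion>k\<in>{..2 ^ n}. ennreal (\<xi> (grid t n k) \<omega>))" for \<omega>
  define H where "H \<omega> = ennreal (\<xi> 0 \<omega>) + (\<integral>\<^sup>+s\<in>{0..t}. ennreal (\<eta> s \<omega>) \<partial>lborel)" for \<omega>
  define h where "h \<omega> = enn2real (H \<omega>)" for \<omega>
  define \<beta> where "\<beta> = (\<integral>\<^sup>+\<omega>. ennreal (exp (p * A t \<omega> / (1 - p))) \<partial>P)"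
  define B where "B \<kappa> \<omega> \<longleftrightarrow> (\<exists>n. \<exists>k\<le>2 ^ n. \<kappa> < \<xi> (grid t n k) \<omega>)" for \<kappa> \<omega>
  have adapted_P: "Y s \<in> borel_measurable P" if "adapted F Y" "0 \<le> s" for Y s
    using that measurable_from_subalg[OF subalgebra_F] by (auto simp: adapted_def)
  have [measurable]: "A t \<in> borel_measurable P" "\<xi> 0 \<in> borel_measurable P" "\<xi> (grid t n k) \<in> borel_measurable P" for n k
    using t by (auto intro!: adapted_P \<xi> A grid_nonneg)
  have H_meas [measurable]: "H \<in> borel_measurable P"
    unfolding H_def by (intro borel_measurable_add measurable_process_nn_integral \<eta>_meas) measurable
  have [measurable]: "Z \<in> borel_measurable P" unfolding Z_def by measurable
  have B_meas [measurable]: "Measurable.pred P (B \<kappa>)" for \<kappa>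
  proof -
    have [measurable]: "Measurable.pred P (\<lambda>\<omega>. \<exists>k\<le>2 ^ n. \<kappa> < \<xi> (grid t n k) \<omega>)" for n
      by (rule pred_ex_atMost) measurable
    show ?thesis unfolding B_def by measurable
  qed
  have A_nonneg: "AE \<omega> in P. 0 \<le> A t \<omega>"
    using A_path A0
  proof eventually_elim
    case (elim \<omega>)
    then show ?case using t mono_onD[of "{0..}" "\<lambda>s. A s \<omega>" 0 t] by auto
  qed
  have S_eq: "AE \<omega> in P. S \<omega> = Z \<omega>"
    using \<xi>_cadlag
  proof eventually_elim
    case (elim \<omega>)
    show ?case unfolding S_def Z_def
      by (rule SUP_grid[OF t]) (use elim in \<open>simp add: cadlag_def\<close>)
  qed
  have Z_finite: "AE \<omega> in P. Z \<omega> \<noteq> \<top>"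
    using \<xi>_cadlag
  proof eventually_elim
    case (elim \<omega>)
    obtain C where C: "\<And>s. s \<in> {0..t} \<Longrightarrow> \<bar>\<xi> s \<omega>\<bar> \<le> C"
      using bounded_cadlag[OF elim t] by blast
    have "ennreal (\<xi> (grid t n k) \<omega>) \<le> ennreal C" if "k \<le> 2 ^ n" for n k
      using C[of "grid t n k"] that t by (intro ennreal_leI) (simp add: grid_nonneg grid_le)
    then have "Z \<omega> \<le> ennreal C" unfolding Z_def by (intro SUP_least) auto
    then show ?case by (metis ennreal_neq_top top.extremum_uniqueI)
  qed
  have \<beta>1: "1 \<le> \<beta>"
  proof -
    have "AE \<omega> in P. 1 \<le> ennreal (exp (p * A t \<omega> / (1 - p)))"
      using A_nonneg by eventually_elim (use p in simp)
    then have "(\<integral>\<^sup>+\<omega>. 1 \<partial>P) \<le> \<beta>" unfolding \<beta>_def by (rule nn_integral_mono_AE)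
    then show ?thesis by (simp add: emeasure_space_1)
  qed
  \<comment> \<open>In \<open>ennreal\<close>, \<open>0 * \<top> = 0\<close>. A nonzero factor is
    therefore needed to make the right side infinite when H is not integrable.\<close>
  have \<beta>_powr: "ennreal_powr \<beta> ((1 - p) / p) \<noteq> 0"
  proof (cases "\<beta> = \<top>")
    case False
    then have "enn2real \<beta> \<noteq> 0" using \<beta>1 by (auto simp: enn2real_eq_0_iff)
    then show ?thesis using False by (simp add: ennreal_powr_def)
  qed (simp add: ennreal_powr_def)
  have LHS: "(\<integral>\<^sup>+\<omega>. ennreal_powr (S \<omega>) q \<partial>P) = (\<integral>\<^sup>+\<omega>. ennreal (enn2real (Z \<omega>) powr q) \<partial>P)"
    using S_eq Z_finite by (intro nn_integral_cong_AE) (auto simp: ennreal_powr_def)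
  have main: "ennreal_powr (\<integral>\<^sup>+\<omega>. ennreal (enn2real (Z \<omega>) powr q) \<partial>P) (1 / q)
    \<le> ennreal c * ennreal_powr \<beta> ((1 - p) / p) * (\<integral>\<^sup>+\<omega>. H \<omega> \<partial>P)"
  proof (cases "(\<integral>\<^sup>+\<omega>. H \<omega> \<partial>P) = \<top>")
    case True
    then show ?thesis using \<beta>_powr c by (simp add: ennreal_mult_top)
  next
    case H_finite: False
    define \<alpha> where "\<alpha> = expectation h"
    have [measurable]: "h \<in> borel_measurable P" unfolding h_def by measurable
    have Hh: "AE \<omega> in P. H \<omega> = ennreal (h \<omega>)"
      using nn_integral_PInf_AE[OF H_meas] H_finite
      by (auto simp: h_def less_top)
    have h0: "0 \<le> h \<omega>" for \<omega> by (simp add: h_def)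
    have H_int: "(\<integral>\<^sup>+\<omega>. H \<omega> \<partial>P) = (\<integral>\<^sup>+\<omega>. ennreal (h \<omega>) \<partial>P)"
      using Hh by (rule nn_integral_cong_AE)
    have h_int: "integrable P h"
      using H_finite H_int h0 by (intro integrableI_nonneg) (auto simp: less_top)
    have EH: "(\<integral>\<^sup>+\<omega>. H \<omega> \<partial>P) = ennreal \<alpha>"
      unfolding H_int \<alpha>_def using h_int h0 by (intro nn_integral_eq_integral) auto
    have \<alpha>0: "0 \<le> \<alpha>" unfolding \<alpha>_def using h0 by simp
    \<comment> \<open>The inequality becomes real-valued with a term \<open>h\<close> that no longer
      depends on u: the integral of \<eta> is enlarged from \<open>{0..u}\<close> to
      \<open>{0..t}\<close>.\<close>
    have le: "AE \<omega> in P. \<forall>u\<in>{0..t}. \<xi> u \<omega> \<le> h \<omega> + (LINT s:{0<..u}|stieltjes_measure (\<lambda>s. A s \<omega>). \<xi> s \<omega>) + M u \<omega>"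
      using assms(14) Hh \<xi>_nonneg \<xi>_cadlag A_path AE_space
    proof eventually_elim
      case (elim \<omega>)
      let ?\<mu> = "stieltjes_measure (\<lambda>s. A s \<omega>)"
      show ?case
      proof
        fix u assume u: "u \<in> {0..t}"
        define g where "g = (LINT s:{0<..u}|?\<mu>. \<xi> s \<omega>)"
        \<comment> \<open>Boundedness of the path makes the integral finite, and the missing atom at
          0 allows passing from \<open>{0..u}\<close> to \<open>{0<..u}\<close>.\<close>
        have g: "(\<integral>\<^sup>+s\<in>{0..u}. ennreal (\<xi> s \<omega>) \<partial>?\<mu>) = ennreal g" and g0: "0 \<le> g"
        proof -
          obtain C where C: "\<And>s. s \<in> {0..t} \<Longrightarrow> \<bar>\<xi> s \<omega>\<bar> \<le> C"
            using bounded_cadlag[OF elim(4) t] by blast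
          have int: "integrable ?\<mu> (\<lambda>s. indicator {0<..u} s *\<^sub>R \<xi> s \<omega>)"
            using set_integrable_stieltjes[of "\<lambda>s. A s \<omega>" 0 u t "\<lambda>s. \<xi> s \<omega>" C]
              measurable_process_section[OF \<xi>_meas elim(6)] elim(5) u C by (auto simp: set_integrable_def)
          have nn: "0 \<le> indicator {0<..u} s *\<^sub>R \<xi> s \<omega>" for s
            using elim(3) by (auto simp: indicator_def)
          have "AE s in ?\<mu>. s \<noteq> 0"
            using emeasure_stieltjes_measure(2)[of "\<lambda>s. A s \<omega>" 0 0] elim(5)
            by (intro AE_I[of _ _ "{0}"]) auto
          then have "AE s in ?\<mu>. ennreal (\<xi> s \<omega>) * indicator {0..u} s = ennreal (indicator {0<..u} s *\<^sub>R \<xi> s \<omega>)"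
            by eventually_elim (auto simp: indicator_def)
          then have "(\<integral>\<^sup>+s\<in>{0..u}. ennreal (\<xi> s \<omega>) \<partial>?\<mu>) = (\<integral>\<^sup>+s. ennreal (indicator {0<..u} s *\<^sub>R \<xi> s \<omega>) \<partial>?\<mu>)"
            by (rule nn_integral_cong_AE)
          also have "\<dots> = ennreal g"
            unfolding g_def set_lebesgue_integral_def using int nn by (intro nn_integral_eq_integral) auto
          finally show "(\<integral>\<^sup>+s\<in>{0..u}. ennreal (\<xi> s \<omega>) \<partial>?\<mu>) = ennreal g" .
          show "0 \<le> g" unfolding g_def set_lebesgue_integral_def using nn by (intro integral_nonneg_AE) auto
        qed
        have "(\<integral>\<^sup>+s\<in>{0..u}. ennreal (\<eta> s \<omega>) \<partial>lborel) \<le> (\<integral>\<^sup>+s\<in>{0..t}. ennreal (\<eta> s \<omega>) \<partial>lborel)"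
          using u by (intro nn_integral_mono) (auto simp: indicator_def)
        then have "ennreal (\<xi> 0 \<omega>) + (\<integral>\<^sup>+s\<in>{0..u}. ennreal (\<eta> s \<omega>) \<partial>lborel) + ennreal g \<le> H \<omega> + ennreal g"
          unfolding H_def by (intro add_mono) auto
        also have "\<dots> = ennreal (h \<omega> + g)"
          unfolding elim(2) using h0 g0 by (simp add: ennreal_plus)
        finally have "enn2ereal (ennreal (\<xi> 0 \<omega>) + (\<integral>\<^sup>+s\<in>{0..u}. ennreal (\<eta> s \<omega>) \<partial>lborel)
            + (\<integral>\<^sup>+s\<in>{0..u}. ennreal (\<xi> s \<omega>) \<partial>?\<mu>)) \<le> ereal (h \<omega> + g)"
          using h0[of \<omega>] g0 unfolding g by (simp add: less_eq_ennreal.rep_eq flip: ennreal_plus)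
        then have "enn2ereal (ennreal (\<xi> 0 \<omega>) + (\<integral>\<^sup>+s\<in>{0..u}. ennreal (\<eta> s \<omega>) \<partial>lborel)
            + (\<integral>\<^sup>+s\<in>{0..u}. ennreal (\<xi> s \<omega>) \<partial>?\<mu>)) + ereal (M u \<omega>) \<le> ereal (h \<omega> + g) + ereal (M u \<omega>)"
          by (rule add_right_mono)
        moreover have "ereal (\<xi> u \<omega>) \<le> enn2ereal (ennreal (\<xi> 0 \<omega>) + (\<integral>\<^sup>+s\<in>{0..u}. ennreal (\<eta> s \<omega>) \<partial>lborel)
            + (\<integral>\<^sup>+s\<in>{0..u}. ennreal (\<xi> s \<omega>) \<partial>?\<mu>)) + ereal (M u \<omega>)"
          using elim(1) u by auto
        ultimately have "ereal (\<xi> u \<omega>) \<le> ereal (h \<omega> + g) + ereal (M u \<omega>)" by (rule order_trans[rotated])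
        then show "\<xi> u \<omega> \<le> h \<omega> + (LINT s:{0<..u}|?\<mu>. \<xi> s \<omega>) + M u \<omega>"
          by (simp add: g_def)
      qed
    qed
    have maximal: "\<kappa> * expectation (\<lambda>\<omega>. exp (- A t \<omega>) * of_bool (B \<kappa> \<omega>)) \<le> \<alpha>" if "0 \<le> \<kappa>" for \<kappa>
      unfolding B_def \<alpha>_def
      by (rule local_martingale_maximal[OF t that \<xi>_meas \<xi> \<xi>_nonneg \<xi>_cadlag A A0 A_path assms(11,12) h_int _ le])
        (simp add: h0)
    have w_int: "integrable P (\<lambda>\<omega>. exp (- A t \<omega>) * of_bool (B \<kappa> \<omega>))" for \<kappa>
      by (intro integrable_const_bound[of _ 1]) (use A_nonneg in auto)
    show ?thesis
    proof (cases "\<alpha> = 0")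
      \<comment> \<open>Young's inequality divides by \<alpha>, so this case is separate: the
        maximal inequality makes every positive level almost surely unreached.\<close>
      case True
      have not_B: "AE \<omega> in P. \<not> B \<kappa> \<omega>" if "0 < \<kappa>" for \<kappa>
      proof -
        have "expectation (\<lambda>\<omega>. exp (- A t \<omega>) * of_bool (B \<kappa> \<omega>)) \<le> 0"
          using maximal[of \<kappa>] that True by (simp add: mult_le_0_iff)
        then have "expectation (\<lambda>\<omega>. exp (- A t \<omega>) * of_bool (B \<kappa> \<omega>)) = 0"
          by (intro antisym integral_nonneg) auto
        then have "AE \<omega> in P. exp (- A t \<omega>) * of_bool (B \<kappa> \<omega>) = 0"
          using integral_nonneg_eq_0_iff_AE[OF w_int[of \<kappa>]] by simp
        then show ?thesis by eventually_elim simp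
      qed
      \<comment> \<open>Countably many levels 1/(m+1) suffice to exclude every positive
        value.\<close>
      have "AE \<omega> in P. \<forall>m. \<not> B (inverse (Suc m)) \<omega>"
        unfolding AE_all_countable using not_B by simp
      then have "AE \<omega> in P. Z \<omega> = 0"
      proof eventually_elim
        case (elim \<omega>)
        have "\<xi> (grid t n k) \<omega> \<le> 0" if "k \<le> 2 ^ n" for n k
        proof (rule ccontr)
          assume "\<not> \<xi> (grid t n k) \<omega> \<le> 0"
          then obtain m where "inverse (Suc m) < \<xi> (grid t n k) \<omega>"
            using reals_Archimedean[of "\<xi> (grid t n k) \<omega>"] by auto
          then show False using elim that unfolding B_def by blast
        qed
        then have "Z \<omega> \<le> 0" unfolding Z_def by (intro SUP_least) (simp add: ennreal_neg)
        then show ?case by simp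
      qed
      then have "(\<integral>\<^sup>+\<omega>. ennreal (enn2real (Z \<omega>) powr q) \<partial>P) = (\<integral>\<^sup>+\<omega>. 0 \<partial>P)"
        by (intro nn_integral_cong_AE) auto
      then show ?thesis by (simp add: ennreal_powr_def)
    next
      case False
      then have \<alpha>: "0 < \<alpha>" using \<alpha>0 by simp
      show ?thesis
      proof (cases "\<beta> = \<top>")
        case True
        then show ?thesis using \<alpha> c by (simp add: EH ennreal_powr_def ennreal_mult_top ennreal_top_mult)
      next
        case \<beta>_finite: False
        define b where "b = expectation (\<lambda>\<omega>. exp (p * A t \<omega> / (1 - p)))"
        have b_int: "integrable P (\<lambda>\<omega>. exp (p * A t \<omega> / (1 - p)))"
          using \<beta>_finite by (intro integrableI_nonneg) (auto simp: \<beta>_def less_top)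
        have \<beta>b: "\<beta> = ennreal b"
          unfolding \<beta>_def b_def using b_int by (intro nn_integral_eq_integral) auto
        have b: "0 < b" using \<beta>1 unfolding \<beta>b by (cases "0 < b") (auto simp: ennreal_neg)
        define K where "K = \<alpha> powr p * b powr (1 - p)"
        have K: "0 < K" using \<alpha> b by (simp add: K_def)
        have "(\<integral>\<^sup>+\<omega>. ennreal (enn2real (Z \<omega>) powr q) \<partial>P) \<le> ennreal (p / (p - q) * K powr (q / p))"
        proof (rule powr_moment_le_of_tail_bound[OF _ _ K \<open>0 < q\<close> \<open>q < p\<close>])
          show "(\<lambda>\<omega>. enn2real (Z \<omega>)) \<in> borel_measurable P" by measurable
          fix \<kappa> :: real assume \<kappa>: "0 < \<kappa>"
          have "B \<kappa> \<omega>" if "\<kappa> < enn2real (Z \<omega>)" for \<omega>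
          proof -
            have "ennreal \<kappa> < Z \<omega>"
              using that \<kappa> by (cases "Z \<omega>") (auto simp: ennreal_less_iff)
            then obtain n k where "k \<le> 2 ^ n" "ennreal \<kappa> < ennreal (\<xi> (grid t n k) \<omega>)"
              unfolding Z_def less_SUP_iff by auto
            then show ?thesis using \<kappa> unfolding B_def by (auto simp: ennreal_less_iff)
          qed
          then have "prob {\<omega> \<in> space P. \<kappa> < enn2real (Z \<omega>)} \<le> prob {\<omega> \<in> space P. B \<kappa> \<omega>}"
            by (intro finite_measure_mono) auto
          also have "\<dots> \<le> K * \<kappa> powr - p"
            unfolding K_def b_def
            by (rule tail_bound_of_exp_weighted) (use p \<kappa> \<alpha> b b_int w_int maximal in \<open>auto simp: b_def\<close>)
          finally show "prob {\<omega> \<in> space P. \<kappa> < enn2real (Z \<omega>)} \<le> K * \<kappa> powr - p" .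
        qed simp
        then have "ennreal_powr (\<integral>\<^sup>+\<omega>. ennreal (enn2real (Z \<omega>) powr q) \<partial>P) (1 / q)
            \<le> ennreal ((p / (p - q) * K powr (q / p)) powr (1 / q))"
          using p \<open>0 < q\<close> \<open>q < p\<close> by (intro ennreal_powr_le) auto
        \<comment> \<open>Taking the root 1/q turns K^(q/p) into K^(1/p), which is \<alpha>
          b^((1-p)/p): the bound becomes linear in the mean of \<open>h\<close>.\<close>
        also have "(p / (p - q) * K powr (q / p)) powr (1 / q) = c * b powr ((1 - p) / p) * \<alpha>"
        proof -
          have "(p / (p - q) * K powr (q / p)) powr (1 / q) = c * K powr (1 / p)"
            using p \<open>0 < q\<close> \<open>q < p\<close> by (subst powr_mult) (simp_all add: c_def powr_powr)
          also have "K powr (1 / p) = \<alpha> * b powr ((1 - p) / p)"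
            using p \<alpha> b by (simp add: K_def powr_mult powr_powr)
          finally show ?thesis by (simp add: mult_ac)
        qed
        also have "ennreal (c * b powr ((1 - p) / p) * \<alpha>)
            = ennreal c * ennreal_powr \<beta> ((1 - p) / p) * (\<integral>\<^sup>+\<omega>. H \<omega> \<partial>P)"
          using b \<alpha> c unfolding EH \<beta>b by (simp add: ennreal_powr_def ennreal_mult)
        finally show ?thesis .
      qed
    qed
  qed
  show ?thesis
    using main unfolding LHS[symmetric] unfolding S_def \<beta>_def H_def c_def .
qed

end
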